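(* Let $n$ be a positive integer and $p_1,\dots,p_n$ distinct primes. Let $(X,r)$ be an indecomposable multipermutation solution of the YBE with $|X|=p_1\cdots p_n$, and let $P_i$ be the Sylow $p_i$-subgroup of the additive group of the left brace $\mathcal G(X,r)$, $i=1,\dots,n$. Then: (i) $\mathrm{soc}(\mathcal G(X,r))$ is a Hall $\pi$-subgroup of the additive group of $\mathcal G(X,r)$ for some non-empty subset $\pi\subseteq\{p_1,\dots,p_n\}$; (ii) $\mathcal G(X,r)=P_1P_2\cdots P_n$ (product in the multiplicative group); in particular $p_1,\dots,p_n$ are the only primes dividing $|\mathcal G(X,r)|$; (iii) each $P_i$ is a trivial brace whose additive group is an elementary abelian $p_i$-group; (iv) there is a permutation $\sigma\in\mathrm{Sym}_n$ such that $P_{\sigma(1)},\ P_{\sigma(1)}P_{\sigma(2)},\ \dots,\ P_{\sigma(1)}P_{\sigma(2)}\cdots P_{\sigma(n)}$ are ideals of the left brace $\mathcal G(X,r)$, $P_{\sigma(1)}\subseteq \mathrm{soc}(\mathcal G(X,r))$, and for every $1<i\le n$, $$(P_{\sigma(1)}\cdots P_{\sigma(i)})/(P_{\sigma(1)}\cdots P_{\sigma(i-1)})\subseteq \mathrm{soc}\big(\mathcal G(X,r)/(P_{\sigma(1)}\cdots P_{\sigma(i-1)})\big);$$ (v) for $1\le i\le n$, letting $K_i=\{g\in\mathcal G(X,r): g(P_{\sigma(1)}\cdots P_{\sigma(i)}(x))=P_{\sigma(1)}\cdots P_{\sigma(i)}(x)\text{ for all }x\in X\}$, where $H(x)=\{h(x):h\in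 H\}$, one has $K_i=P_{\sigma(1)}\cdots P_{\sigma(i)}$.
   Context: A solution of the Yang–Baxter equation (YBE) is a pair $(X,r)$, where $X$ is a non-empty set and $r\colon X\times X\to X\times X$, written $r(x,y)=(\sigma_x(y),\gamma_y(x))$, satisfies: $r^2=\mathrm{id}$; all maps $\sigma_x,\gamma_y$ are bijections of $X$; and $r_{12}r_{23}r_{12}=r_{23}r_{12}r_{23}$ on $X^3$, where $r_{12}=r\times\mathrm{id}_X$, $r_{23}=\mathrm{id}_X\times r$. $\mathcal G(X,r)=\langle\sigma_x:x\in X\rangle\le\mathrm{Sym}_X$; $(X,r)$ is indecomposable if $\mathcal G(X,r)$ is transitive on $X$. Retract: $x\sim y\iff\sigma_x=\sigma_y$, inducing a solution $\mathrm{Ret}(X,r)$ on $X/{\sim}$; $(X,r)$ is multipermutation if the iterated retract $\mathrm{Ret}^k(X,r)$ has one element for some $k\ge1$ (least such $k$ = multipermutation level). A left brace is a set $B$ with operations $+$ and $\circ$ (written $ab=a\circ b$) such that $(B,+)$ is an abelian group, $(B,\circ)$ is a group, and $a(b+c)+a=ab+ac$ for all $a,b,c$. Then $\lambda_a(b)=-a+ab$ defines a homomorphism $\lambda\colon(B,\circ)\to\mathrm{Aut}(B,+)$. $B$ is trivial if $ab=a+b$ for all $a,b$. The socle is $\mathrm{soc}(B)=\{a\in B: ab=a+b\ \forall b\in B\}=\ker\lambda$. A left ideal is an additive subgroup $L$ with $\lambda_a(L)\subseteq L$ for all $a\in B$; an ideal is a normal subgroup $I$ of $(B,\circ)$ with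 $\lambda_a(I)\subseteq I$ for all $a$ (ideals are additive subgroups and $B/I$ is a left brace). Sylow subgroups of $(B,+)$ of a finite left brace are left ideals, hence also subgroups of $(B,\circ)$. Brace structure on $\mathcal G(X,r)$: the structure group $G(X,r)=\langle x\in X\mid xy=\sigma_x(y)\gamma_y(x)\ \forall x,y\rangle$ is a left brace with additive group free abelian on $X$ and $\lambda_x(y)=\sigma_x(y)$; the map $x\mapsto\sigma_x$ extends to a group epimorphism $\phi\colon G(X,r)\to\mathcal G(X,r)$ with kernel $\mathrm{soc}(G(X,r))$, and $\mathcal G(X,r)$ is given the unique left brace structure (with its composition as multiplication) making $\phi$ a homomorphism of left braces. It satisfies $\lambda_g(\sigma_y)=\sigma_{g(y)}$ for all $g\in\mathcal G(X,r)$, $y\in X$. *)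

theory Defs
  imports "HOL-Algebra.Algebra" "HOL-Computational_Algebra.Primes" "HOL-Combinatorics.Permutations"
begin

definition sol_r :: "('a \<Rightarrow> 'a \<Rightarrow> 'a) \<Rightarrow> ('a \<Rightarrow> 'a \<Rightarrow> 'a) \<Rightarrow> 'a \<times> 'a \<Rightarrow> 'a \<times> 'a" where
  "sol_r sig gam = (\<lambda>(x, y). (sig x y, gam y x))"

definition r12 :: "('a \<times> 'a \<Rightarrow> 'a \<times> 'a) \<Rightarrow> 'a \<times> 'a \<times> 'a \<Rightarrow> 'a \<times> 'a \<times> 'a" where
  "r12 r = (\<lambda>(x, y, z). (let (u, v) = r (x, y) in (u, v, z)))"

definition r23 :: "('a \<times> 'a \<Rightarrow> 'a \<times> 'a) \<Rightarrow> 'a \<times> 'a \<times> 'a \<Rightarrow> 'a \<times> 'a \<times> 'a" where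
  "r23 r = (\<lambda>(x, y, z). (let (u, v) = r (y, z) in (x, u, v)))"

definition is_solution :: "('a \<Rightarrow> 'a \<Rightarrow> 'a) \<Rightarrow> ('a \<Rightarrow> 'a \<Rightarrow> 'a) \<Rightarrow> bool" where
  "is_solution sig gam \<longleftrightarrow>
     sol_r sig gam \<circ> sol_r sig gam = id \<and>
     (\<forall>x. bij (sig x)) \<and> (\<forall>y. bij (gam y)) \<and>
     r12 (sol_r sig gam) \<circ> r23 (sol_r sig gam) \<circ> r12 (sol_r sig gam)
       = r23 (sol_r sig gam) \<circ> r12 (sol_r sig gam) \<circ> r23 (sol_r sig gam)"

inductive_set permgrp :: "('a \<Rightarrow> 'a \<Rightarrow> 'a) \<Rightarrow> ('a \<Rightarrow> 'a) set" for sig where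
  pg_id: "id \<in> permgrp sig"
| pg_gen: "g \<in> permgrp sig \<Longrightarrow> g \<circ> sig x \<in> permgrp sig"
| pg_inv: "g \<in> permgrp sig \<Longrightarrow> g \<circ> inv_into UNIV (sig x) \<in> permgrp sig"

definition indecomposable :: "('a \<Rightarrow> 'a \<Rightarrow> 'a) \<Rightarrow> bool" where
  "indecomposable sig \<longleftrightarrow> (\<forall>x y. \<exists>g\<in>permgrp sig. g x = y)"

(* ret_rel sig k x y: x and y have the same image in Ret^k(X,r);
   Ret^(k+1) identifies [x]_k,[y]_k iff sigma_[x] = sigma_[y] on Ret^k. *)
fun ret_rel :: "('a \<Rightarrow> 'a \<Rightarrow> 'a) \<Rightarrow> nat \<Rightarrow> 'a \<Rightarrow> 'a \<Rightarrow> bool" where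
  "ret_rel sig 0 x y = (x = y)"
| "ret_rel sig (Suc k) x y = (\<forall>z. ret_rel sig k (sig x z) (sig y z))"

definition multipermutation :: "('a \<Rightarrow> 'a \<Rightarrow> 'a) \<Rightarrow> bool" where
  "multipermutation sig \<longleftrightarrow> (\<exists>k\<ge>1. \<forall>x y. ret_rel sig k x y)"

(* Structure group G(X,r) in the Etingof-Schedler-Soloviev model: the subgroup of
   Z^X \<rtimes> Sym_X generated by (e_x, sig x), with (a,g)(b,h) = (a + g.b, g \<circ> h),
   (g.b)(y) = b(g^-1 y).  Its first coordinate is the additive group (free abelian on X),
   its second coordinate is the brace epimorphism \<phi> onto \<G>(X,r). *)
inductive_set Gam :: "('a \<Rightarrow> 'a \<Rightarrow> 'a) \<Rightarrow> (('a \<Rightarrow> int) \<times> ('a \<Rightarrow> 'a)) set" for sig where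
  Gam_one: "((\<lambda>_. 0), id) \<in> Gam sig"
| Gam_gen: "(a, g) \<in> Gam sig \<Longrightarrow>
    ((\<lambda>z. a z + (if z = g x then 1 else 0)), g \<circ> sig x) \<in> Gam sig"
| Gam_inv: "(a, g) \<in> Gam sig \<Longrightarrow>
    ((\<lambda>z. a z - (if z = g (inv_into UNIV (sig x) x) then 1 else 0)), g \<circ> inv_into UNIV (sig x)) \<in> Gam sig"

(* the addition of the left brace \<G>(X,r): \<phi>(a) + \<phi>(b) = \<phi>(a + b) *)
definition gadd :: "('a \<Rightarrow> 'a \<Rightarrow> 'a) \<Rightarrow> ('a \<Rightarrow> 'a) \<Rightarrow> ('a \<Rightarrow> 'a) \<Rightarrow> ('a \<Rightarrow> 'a)" where
  "gadd sig g h = (THE k. \<exists>a b. (a, g) \<in> Gam sig \<and> (b, h) \<in> Gam sig \<and>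
                              ((\<lambda>z. a z + b z), k) \<in> Gam sig)"

definition addG :: "('a \<Rightarrow> 'a \<Rightarrow> 'a) \<Rightarrow> ('a \<Rightarrow> 'a) monoid" where
  "addG sig = \<lparr>carrier = permgrp sig, monoid.mult = gadd sig, monoid.one = id\<rparr>"

definition mulG :: "('a \<Rightarrow> 'a \<Rightarrow> 'a) \<Rightarrow> ('a \<Rightarrow> 'a) monoid" where
  "mulG sig = \<lparr>carrier = permgrp sig, monoid.mult = (\<circ>), monoid.one = id\<rparr>"

definition blam :: "('a \<Rightarrow> 'a \<Rightarrow> 'a) \<Rightarrow> ('a \<Rightarrow> 'a) \<Rightarrow> ('a \<Rightarrow> 'a) \<Rightarrow> ('a \<Rightarrow> 'a)" where
  "blam sig g h = gadd sig (inv\<^bsub>addG sig\<^esub> g) (g \<circ> h)"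

definition soc :: "('a \<Rightarrow> 'a \<Rightarrow> 'a) \<Rightarrow> ('a \<Rightarrow> 'a) set" where
  "soc sig = {a \<in> permgrp sig. \<forall>b\<in>permgrp sig. a \<circ> b = gadd sig a b}"

definition brace_ideal :: "('a \<Rightarrow> 'a \<Rightarrow> 'a) \<Rightarrow> ('a \<Rightarrow> 'a) set \<Rightarrow> bool" where
  "brace_ideal sig I \<longleftrightarrow> I \<lhd> mulG sig \<and> (\<forall>a\<in>permgrp sig. \<forall>x\<in>I. blam sig a x \<in> I)"

definition quot_soc :: "('a \<Rightarrow> 'a \<Rightarrow> 'a) \<Rightarrow> ('a \<Rightarrow> 'a) set \<Rightarrow> ('a \<Rightarrow> 'a) set set" where
  "quot_soc sig J = {a <#\<^bsub>mulG sig\<^esub> J | a. a \<in> permgrp sig \<and>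
      (\<forall>b\<in>permgrp sig. (a \<circ> b) <#\<^bsub>mulG sig\<^esub> J = (gadd sig a b) <#\<^bsub>mulG sig\<^esub> J)}"

definition quot_img :: "('a \<Rightarrow> 'a \<Rightarrow> 'a) \<Rightarrow> ('a \<Rightarrow> 'a) set \<Rightarrow> ('a \<Rightarrow> 'a) set \<Rightarrow> ('a \<Rightarrow> 'a) set set" where
  "quot_img sig I J = {a <#\<^bsub>mulG sig\<^esub> J | a. a \<in> I}"

fun mprod :: "('a \<Rightarrow> 'a \<Rightarrow> 'a) \<Rightarrow> (nat \<Rightarrow> ('a \<Rightarrow> 'a) set) \<Rightarrow> nat \<Rightarrow> ('a \<Rightarrow> 'a) set" where
  "mprod sig Q 0 = {id}"
| "mprod sig Q (Suc k) = mprod sig Q k <#>\<^bsub>mulG sig\<^esub> Q k"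

definition stabset :: "('a \<Rightarrow> 'a \<Rightarrow> 'a) \<Rightarrow> ('a \<Rightarrow> 'a) set \<Rightarrow> ('a \<Rightarrow> 'a) set" where
  "stabset sig H = {g \<in> permgrp sig. \<forall>x. g ` ((\<lambda>h. h x) ` H) = (\<lambda>h. h x) ` H}"

definition sylow_subgroup :: "('b, 'c) monoid_scheme \<Rightarrow> nat \<Rightarrow> 'b set \<Rightarrow> bool" where
  "sylow_subgroup G p P \<longleftrightarrow> subgroup P G \<and> card P = p ^ Factorial_Ring.multiplicity p (order G)"

definition hall_subgroup :: "('b, 'c) monoid_scheme \<Rightarrow> nat set \<Rightarrow> 'b set \<Rightarrow> bool" where
  "hall_subgroup G \<pi> H \<longleftrightarrow> subgroup H G \<and>
     (\<forall>q. Factorial_Ring.prime q \<and> q dvd card H \<longrightarrow> q \<in> \<pi>) \<and>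
     (\<forall>q\<in>\<pi>. \<not> q dvd (order G div card H))"

end

(*
  Let B be the brace and N_0 = 1, N_1 = soc B, N_2, ... its socle series. By induction on k, N_k is
  the kernel of the action of B on Ret^k(X, r); hence the series reaches B, and N_k contains every
  element that maps each x into its own N_k-orbit.
  Let D_k be the common size of the N_k-orbits. Since N_(k+1) / N_k is abelian and acts transitively
  on the D_(k+1) / D_k many N_k-orbits in an N_(k+1)-orbit, g^(D_(k+1) / D_k) lies in N_k for
  every g in N_(k+1). So the primes dividing |N_k| divide D_k and those dividing |B : N_k| divide
  |X| / D_k, which are coprime as |X| is squarefree: all N_k are Hall subgroups. The Sylow subgroup
  for a prime that first divides D_(k+1) embeds in N_(k+1) / N_k, where addition and multiplication
  agree and the exponent is squarefree. Listing the primes by the index at which they first divide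
  D_k gives the chain of ideals.
*)
theory Submission
  imports Defs "HOL-Computational_Algebra.Squarefree"
begin

section \<open>Finite groups\<close>

text \<open>The induction on retracts rests on \<open>lam g (sig x) = sig (g x)\<close> and on the
  \<open>sig x\<close> generating the additive group: g is in the socle modulo N_k iff
  \<open>sig (g x)\<close> and \<open>sig x\<close> are congruent modulo N_k for all x, and this
  congruence is the retract relation of order k + 1. Quotient braces are never formed. Additive and
  multiplicative cosets of a left ideal coincide, so congruences inside B do their work. Orbit sizes
  bound exponents, not orders: N_(k+1) / N_k need not act faithfully on the N_k-orbits inside one
  N_(k+1)-orbit, and B can be larger than X. Exponents suffice because a prime dividing the order of
  a finite group divides each of its exponents. Ideals of the chain may lie strictly between two
  terms of the series, so neither normality nor the description as a kernel is inherited from the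
  terms. Both are derived from N_(k+1) / N_k being the socle of B / N_k. Addition on B is given by a
  definite description over the structure group. It becomes computable because X is finite: every
  element of B is the image of a nonnegative vector, that is, of a multiset over X.\<close>

lemma (in group) coprime_pow_mem:
  fixes m n :: nat
  assumes "subgroup H G" "x \<in> carrier G" "x [^] m \<in> H" "x [^] n \<in> H" "coprime m n"
  shows "x \<in> H"
proof -
  interpret H: subgroup H G by fact
  obtain u v where uv: "u * int m + v * int n = 1"
    using bezout_int[of "int m" "int n"] \<open>coprime m n\<close> by auto
  have pw: "x [^] (u * int k) \<in> H" if "x [^] k \<in> H" for u k
  proof -
    have "x [^] (u * int k) = (x [^] k) [^] u"
      using assms(2) by (metis int_pow_int int_pow_pow mult.commute)
    moreover have "(x [^] k) [^] u \<in> H"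
      using that by (metis subgroup_int_pow_closed assms(1))
    ultimately show ?thesis by simp
  qed
  have "x [^] (u * int m + v * int n) \<in> H"
    using assms pw by (simp add: int_pow_mult)
  thus ?thesis using uv assms(2) by (simp add: int_pow_1)
qed

lemma (in group) pow_index_mem:
  assumes "N \<lhd> G" "finite (carrier G)" "x \<in> carrier G"
  shows "x [^] (order G div card N) \<in> N"
proof -
  interpret N: normal N G by fact
  interpret Q: group "G Mod N" by (rule N.factorgroup_is_group)
  have sub: "subgroup N G" by (rule N.subgroup_axioms)
  have fin: "finite N" using N.subset assms(2) finite_subset by blast
  have "card N > 0" using fin N.one_closed card_gt_0_iff by blast
  hence ord: "order (G Mod N) = order G div card N"
    using lagrange[OF sub] by (simp add: order_def FactGroup_def) (metis nonzero_mult_div_cancel_right less_numeral_extra(3) order_def)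
  have "(N #> x) [^]\<^bsub>G Mod N\<^esub> order (G Mod N) = \<one>\<^bsub>G Mod N\<^esub>"
    by (rule Q.pow_order_eq_1) (auto simp: FactGroup_def RCOSETS_def assms)
  hence "N #> (x [^] (order G div card N)) = N"
    using assms(3) by (simp add: N.FactGroup_pow ord)
  thus ?thesis using rcos_self[OF _ sub] assms(3) by blast
qed

text \<open>A form of Cauchy's theorem: a Sylow q-subgroup is nontrivial, and an element of q-power
  order killed by m is trivial once m is prime to q. It turns exponent bounds coming from orbits
  into statements about the primes of an order.\<close>

lemma (in group) prime_dvd_exponent:
  assumes "finite (carrier G)" "Factorial_Ring.prime q" "q dvd order G"
    and "\<And>x. x \<in> carrier G \<Longrightarrow> x [^] (m::nat) = \<one>"
  shows "q dvd m"
proof -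
  define a where "a = multiplicity q (order G)"
  have o: "order G \<noteq> 0" using assms(1) order_gt_0_iff_finite by simp
  obtain k where "order G = q ^ a * k"
    using multiplicity_dvd[of q "order G"] unfolding a_def by (elim dvdE)
  then obtain H where H: "subgroup H G" "card H = q ^ a"
    using sylow_thm[of q G a k] assms(1,2) is_group by auto
  have "a > 0"
    using assms(2,3) o by (simp add: a_def prime_multiplicity_gt_zero_iff)
  hence "card H > 1" using H(2) assms(2)
    by (metis one_less_power prime_gt_1_nat)
  have finH: "finite H" using H(2) assms(2) by (metis H(1) assms(1) finite_subset subgroup.subset)
  have "H \<noteq> {\<one>}" using \<open>card H > 1\<close> by auto
  then obtain g where g: "g \<in> H" "g \<noteq> \<one>"
    using subgroup.one_closed[OF H(1)] by blast
  have gG: "g \<in> carrier G" using g H(1) subgroup.subset by blast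
  show ?thesis
  proof (rule ccontr)
    assume "\<not> q dvd m"
    hence cop: "coprime (q ^ a) m" using assms(2) by (simp add: prime_imp_coprime)
    interpret K: group "G\<lparr>carrier := H\<rparr>" using H(1) subgroup.subgroup_is_group is_group by blast
    have "g [^]\<^bsub>G\<lparr>carrier := H\<rparr>\<^esub> card H = \<one>"
      using K.pow_order_eq_1[of g] g(1) by (simp add: order_def)
    hence "g [^] (q ^ a) = \<one>"
      using H(2) nat_pow_consistent by metis
    hence "g \<in> {\<one>}"
      using coprime_pow_mem[OF triv_subgroup gG _ _ cop] assms(4)[OF gG] by simp
    thus False using g(2) by simp
  qed
qed

lemma (in group) prime_dvd_card_subgroup:
  assumes "finite (carrier G)" "subgroup H G" "Factorial_Ring.prime q" "q dvd card H"
    and "\<And>x. x \<in> H \<Longrightarrow> x [^] (m::nat) = \<one>"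
  shows "q dvd m"
proof -
  interpret K: group "G\<lparr>carrier := H\<rparr>" using assms(2) subgroup.subgroup_is_group is_group by blast
  show ?thesis
  proof (rule K.prime_dvd_exponent)
    show "finite (carrier (G\<lparr>carrier := H\<rparr>))"
      using assms(1,2) finite_subset subgroup.subset by auto
  qed (use assms in \<open>auto simp: order_def nat_pow_consistent[symmetric]\<close>)
qed

lemma (in group) prime_dvd_index:
  assumes "finite (carrier G)" "N \<lhd> G" "Factorial_Ring.prime q" "q dvd order G div card N"
    and "\<And>x. x \<in> carrier G \<Longrightarrow> x [^] (m::nat) \<in> N"
  shows "q dvd m"
proof -
  interpret N: normal N G by fact
  interpret Q: group "G Mod N" by (rule N.factorgroup_is_group)
  have sub: "subgroup N G" by (rule N.subgroup_axioms)
  have "finite N" using N.subset assms(1) finite_subset by blast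
  hence "card N > 0" using N.one_closed card_gt_0_iff by blast
  hence ord: "order (G Mod N) = order G div card N"
    using lagrange[OF sub] by (simp add: order_def FactGroup_def) (metis nonzero_mult_div_cancel_right less_numeral_extra(3) order_def)
  show ?thesis
  proof (rule Q.prime_dvd_exponent)
    show "finite (carrier (G Mod N))"
      using assms(1) by (simp add: FactGroup_def RCOSETS_def)
    show "Y [^]\<^bsub>G Mod N\<^esub> m = \<one>\<^bsub>G Mod N\<^esub>" if Y: "Y \<in> carrier (G Mod N)" for Y
    proof -
      obtain y where y: "y \<in> carrier G" "Y = N #> y"
        using Y unfolding carrier_FactGroup by blast
      hence "N #> (y [^] m) = N" using assms(5) sub by (intro coset_join2) auto
      thus ?thesis using y by (simp add: N.FactGroup_pow)
    qed
  qed (use assms ord in auto)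
qed

lemma (in group) card_subgroup_dvd:
  assumes "subgroup H G" shows "card H dvd order G"
  by (metis lagrange[OF assms] dvd_triv_right)

lemma (in group) card_subgroup_dvd_subgroup:
  assumes "subgroup H G" "subgroup K G" "H \<subseteq> K" shows "card H dvd card K"
proof -
  interpret K: group "G\<lparr>carrier := K\<rparr>" using assms(2) subgroup.subgroup_is_group is_group by blast
  have "subgroup H (G\<lparr>carrier := K\<rparr>)" using assms by (simp add: subgroup_incl)
  from K.card_subgroup_dvd[OF this] show ?thesis by (simp add: order_def)
qed

lemma (in group) pow_card_subgroup:
  assumes "subgroup H G" "x \<in> H"
  shows "x [^] card H = \<one>"
proof -
  interpret K: group "G\<lparr>carrier := H\<rparr>" using assms(1) subgroup.subgroup_is_group is_group by blast
  show ?thesis using K.pow_order_eq_1[of x] assms(2) by (simp add: order_def flip: nat_pow_consistent)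
qed

text \<open>For x in H the power \<open>x [^] card H\<close> is trivial and the power by the index
  of N lies in N; the exponents are coprime, so x lies in N. For a Hall subgroup N, inclusions can
  thus be read off from prime divisors.\<close>

lemma (in group) subgroup_le_of_coprime_index:
  assumes "finite (carrier G)" "subgroup H G" "N \<lhd> G" "coprime (card H) (order G div card N)"
  shows "H \<subseteq> N"
proof
  fix x assume x: "x \<in> H"
  have N: "subgroup N G" using assms(3) by (simp add: normal_def)
  have xG: "x \<in> carrier G" using assms(2) x subgroup.subset by blast
  have "x [^] card H \<in> N" using pow_card_subgroup[OF assms(2) x] subgroup.one_closed[OF N] by simp
  thus "x \<in> N"
    using coprime_pow_mem[OF N xG _ pow_index_mem[OF assms(3,1) xG] assms(4)] by blast
qed

lemma (in group) inter_trivial_of_coprime_card: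
  assumes "subgroup H G" "subgroup K G" "coprime (card H) (card K)" "x \<in> H" "x \<in> K"
  shows "x = \<one>"
  using coprime_pow_mem[OF triv_subgroup _ _ _ assms(3), of x] pow_card_subgroup assms subgroup.subset
  by blast

lemma coprime_of_no_common_prime:
  fixes m n :: nat
  assumes "\<And>q. Factorial_Ring.prime q \<Longrightarrow> q dvd m \<Longrightarrow> q dvd n \<Longrightarrow> False"
  shows "coprime m n"
  using assms by (metis coprime_iff_gcd_eq_1 gcd_nat.bounded_iff prime_factor_nat)

section \<open>Orbits of normal subgroups of a permutation group\<close>

locale perm_group = group G for G :: "('a::finite \<Rightarrow> 'a, 'c) monoid_scheme" (structure) +
  assumes mult_eq: "g \<otimes> h = g \<circ> h" and one_eq: "\<one> = id"
begin

definition orb :: "('a \<Rightarrow> 'a) set \<Rightarrow> 'a \<Rightarrow> 'a set" where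
  "orb H x = (\<lambda>h. h x) ` H"

lemma inv_apply [simp]: "g \<in> carrier G \<Longrightarrow> (inv g) (g x) = x" "g \<in> carrier G \<Longrightarrow> g ((inv g) x) = x"
  using l_inv[of g] r_inv[of g] by (simp_all add: mult_eq one_eq fun_eq_iff)

lemma mult_apply: "(g \<otimes> h) x = g (h x)"
  by (simp add: mult_eq)

text \<open>Orbit-stabilizer for a part Y of the orbit: the elements of H sending x to a given point
  of Y form a left coset of the stabilizer. Y will be the orbit of a smaller normal subgroup, or the
  whole orbit.\<close>

lemma card_transporter:
  assumes H: "subgroup H G" and Y: "Y \<subseteq> orb H x"
  shows "card {h \<in> H. h x \<in> Y} = card Y * card {h \<in> H. h x = x}"
proof -
  interpret H: subgroup H G by fact
  have fib: "card {h \<in> H. h x = y} = card {h \<in> H. h x = x}" if y: "y \<in> Y" for y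
  proof -
    obtain k where k: "k \<in> H" "y = k x" using y Y by (auto simp: orb_def)
    have kG: "k \<in> carrier G" using k H.subset by blast
    have inv: "inv k \<otimes> (k \<otimes> h) = h" "k \<otimes> (inv k \<otimes> h) = h" for h
      using kG by (simp_all add: fun_eq_iff mult_apply)
    have "bij_betw (\<lambda>h. k \<otimes> h) {h \<in> H. h x = x} {h \<in> H. h x = y}"
    proof (rule bij_betwI[where g = "\<lambda>h. inv k \<otimes> h"])
      show "(\<lambda>h. k \<otimes> h) \<in> {h \<in> H. h x = x} \<rightarrow> {h \<in> H. h x = y}"
        using k by (simp add: mult_apply)
      show "(\<lambda>h. inv k \<otimes> h) \<in> {h \<in> H. h x = y} \<rightarrow> {h \<in> H. h x = x}"
        using k kG by (simp add: mult_apply)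
    qed (simp_all add: inv)
    from bij_betw_same_card[OF this] show ?thesis by simp
  qed
  have "{h \<in> H. h x \<in> Y} = (\<Union>y\<in>Y. {h \<in> H. h x = y})" by auto
  also have "card \<dots> = (\<Sum>y\<in>Y. card {h \<in> H. h x = y})"
    by (rule card_UN_disjoint) auto
  also have "\<dots> = card Y * card {h \<in> H. h x = x}"
    using fib by simp
  finally show ?thesis .
qed

lemma card_orb_normal:
  assumes "N \<lhd> G" "g \<in> carrier G" shows "card (orb N (g x)) = card (orb N x)"
proof -
  interpret N: normal N G by fact
  have sub: "g ` orb N x \<subseteq> orb N (g x)" if "g \<in> carrier G" for g x
  proof (clarsimp simp: orb_def)
    fix h assume "h \<in> N"
    hence "g \<otimes> h \<otimes> inv g \<in> N" using that N.inv_op_closed2 by blast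
    moreover have "g (h x) = (g \<otimes> h \<otimes> inv g) (g x)" using that by (simp add: mult_apply)
    ultimately show "g (h x) \<in> (\<lambda>h. h (g x)) ` N" by blast
  qed
  have inj: "inj g" if "g \<in> carrier G" for g
    using inv_apply(1)[OF that] by (rule inj_on_inverseI)
  have "card (orb N x) \<le> card (orb N (g x))" if g: "g \<in> carrier G" for g x
  proof -
    have "card (orb N x) = card (g ` orb N x)"
      using inj_on_subset[OF inj[OF g]] by (simp add: card_image)
    also have "\<dots> \<le> card (orb N (g x))"
      by (rule card_mono[OF _ sub[OF g]]) simp
    finally show ?thesis .
  qed
  from this[OF assms(2), of x] this[OF inv_closed[OF assms(2)], of "g x"] assms(2)
  show ?thesis by simp
qed

text \<open>The stabilizer S in H of the set \<open>orb N x\<close> contains N, so it is normal in H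
  because H / N is abelian. Its index in H is the quotient of the two orbit sizes, and h raised to
  this index lies in S.\<close>

lemma orb_quotient:
  assumes H: "subgroup H G" and N: "N \<lhd> G" and NH: "N \<subseteq> H"
    and comm: "\<And>a b. a \<in> H \<Longrightarrow> b \<in> H \<Longrightarrow> inv (b \<otimes> a) \<otimes> (a \<otimes> b) \<in> N"
  shows card_orb_dvd: "card (orb N x) dvd card (orb H x)"
    and pow_mem_orb: "h \<in> H \<Longrightarrow> (h [^] (card (orb H x) div card (orb N x))) x \<in> orb N x"
proof -
  interpret H: subgroup H G by fact
  interpret N: normal N G by fact
  define S where "S = {h \<in> H. h x \<in> orb N x}"
  have HG: "h \<in> carrier G" if "h \<in> H" for h using that H.subset by blast
  have NG: "h \<in> carrier G" if "h \<in> N" for h using that N.subset by blast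
  have x: "x \<in> orb N x" unfolding orb_def using N.one_closed by (intro image_eqI[of _ _ "\<one>"]) (simp_all add: one_eq)
  have NS: "N \<subseteq> S" using NH by (auto simp: S_def orb_def)
  have S_iff: "h \<in> S \<longleftrightarrow> h \<in> H \<and> (\<exists>k\<in>N. h x = k x)" for h
    by (auto simp: S_def orb_def)
  have S_mult: "a \<otimes> b \<in> S" if ab: "a \<in> S" "b \<in> S" for a b
  proof -
    obtain k l where kl: "a \<in> H" "b \<in> H" "k \<in> N" "l \<in> N" "a x = k x" "b x = l x"
      using ab by (auto simp: S_iff)
    have "a \<otimes> l \<otimes> inv a \<in> N" using kl HG N.inv_op_closed2 by blast
    hence "(a \<otimes> l \<otimes> inv a) \<otimes> k \<in> N" using kl by simp
    moreover have "(a \<otimes> b) x = ((a \<otimes> l \<otimes> inv a) \<otimes> k) x"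
      using kl(1-4) HG by (simp add: mult_apply flip: kl(5)) (simp add: kl(6))
    ultimately show ?thesis using kl by (auto simp: S_iff)
  qed
  have S_inv: "inv a \<in> S" if a: "a \<in> S" for a
  proof -
    obtain k where kl: "a \<in> H" "k \<in> N" "a x = k x"
      using a by (auto simp: S_iff)
    have "inv a \<otimes> inv k \<otimes> a \<in> N" using kl HG N.inv_op_closed1 by simp
    moreover have "(inv a \<otimes> inv k \<otimes> a) x = (inv a) x"
      using kl HG NG by (simp add: mult_apply)
    ultimately have "\<exists>k\<in>N. (inv a) x = k x" by metis
    thus ?thesis using kl by (simp add: S_iff)
  qed
  have S: "subgroup S G"
  proof (rule subgroupI)
    show "S \<subseteq> carrier G" using HG by (auto simp: S_def)
    show "S \<noteq> {}" using NS N.one_closed by blast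
  qed (use S_mult S_inv in auto)
  interpret K: group "G\<lparr>carrier := H\<rparr>" using H subgroup.subgroup_is_group is_group by blast
  have SH: "subgroup S (G\<lparr>carrier := H\<rparr>)" using S H by (intro subgroup_incl) (auto simp: S_def)
  have nS: "S \<lhd> G\<lparr>carrier := H\<rparr>"
  proof (rule K.normal_invI[OF SH])
    fix a s assume "a \<in> carrier (G\<lparr>carrier := H\<rparr>)" "s \<in> S"
    hence a: "a \<in> H" and s: "s \<in> S" "s \<in> H" by (auto simp: S_def)
    \<comment> \<open>The conjugate of s is s times a commutator, and commutators lie in N, hence in
      S.\<close>
    have "s \<otimes> (inv (inv a \<otimes> s) \<otimes> (s \<otimes> inv a)) \<in> S"
      using comm[of s "inv a"] a s NS by (intro S_mult[OF s(1)]) auto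
    moreover have "s \<otimes> (inv (inv a \<otimes> s) \<otimes> (s \<otimes> inv a)) = a \<otimes> s \<otimes> inv a"
      using a s(2) HG by (simp add: fun_eq_iff mult_apply inv_mult_group)
    ultimately show "a \<otimes>\<^bsub>G\<lparr>carrier := H\<rparr>\<^esub> s \<otimes>\<^bsub>G\<lparr>carrier := H\<rparr>\<^esub> inv\<^bsub>G\<lparr>carrier := H\<rparr>\<^esub> a \<in> S"
      using a by (simp add: m_inv_consistent[OF H])
  qed
  have sub: "orb N x \<subseteq> orb H x" using NH by (auto simp: orb_def)
  have cS: "card S = card (orb N x) * card {h \<in> H. h x = x}"
    unfolding S_def by (rule card_transporter[OF H sub])
  have "{h \<in> H. h x \<in> orb H x} = H" by (auto simp: orb_def)
  with card_transporter[OF H subset_refl, of x]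
  have cH: "card H = card (orb H x) * card {h \<in> H. h x = x}" by simp
  have "id \<in> {h \<in> H. h x = x}" using H.one_closed one_eq by auto
  hence "card {h \<in> H. h x = x} \<noteq> 0" by auto
  \<comment> \<open>t is the order of the stabilizer of x in H. It is common to both counts and
    cancels.\<close>
  then obtain t where t: "t \<noteq> 0" "card S = card (orb N x) * t" "card H = card (orb H x) * t"
    using cS cH by blast
  have "card S dvd card H" using K.card_subgroup_dvd[OF SH] by (simp add: order_def)
  thus "card (orb N x) dvd card (orb H x)" using t by simp
  assume h: "h \<in> H"
  have "card H div card S = card (orb H x) div card (orb N x)"
    using t by simp
  moreover have "h [^]\<^bsub>G\<lparr>carrier := H\<rparr>\<^esub> (card H div card S) \<in> S"
    using K.pow_index_mem[OF nS, of h] h by (simp add: order_def)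
  ultimately have "h [^] (card (orb H x) div card (orb N x)) \<in> S"
    using nat_pow_consistent by metis
  thus "(h [^] (card (orb H x) div card (orb N x))) x \<in> orb N x" by (simp add: S_def)
qed

end

section \<open>Left braces\<close>

text \<open>Two group records on one carrier make subgroups, normality, powers and indices available
  for either operation.\<close>

locale left_brace = add: comm_group A + mul: group M
  for A :: "('b, 'c) monoid_scheme" and M :: "('b, 'd) monoid_scheme" +
  assumes carrier_eq: "carrier M = carrier A"
    and brace_distrib: "\<lbrakk>a \<in> carrier A; b \<in> carrier A; c \<in> carrier A\<rbrakk> \<Longrightarrow>
      (a \<otimes>\<^bsub>M\<^esub> (b \<otimes>\<^bsub>A\<^esub> c)) \<otimes>\<^bsub>A\<^esub> a = (a \<otimes>\<^bsub>M\<^esub> b) \<otimes>\<^bsub>A\<^esub> (a \<otimes>\<^bsub>M\<^esub> c)"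
begin

abbreviation B where "B \<equiv> carrier A"
abbreviation badd (infixl "\<boxplus>" 65) where "a \<boxplus> b \<equiv> a \<otimes>\<^bsub>A\<^esub> b"
abbreviation bmul (infixl "\<star>" 70) where "a \<star> b \<equiv> a \<otimes>\<^bsub>M\<^esub> b"
abbreviation neg where "neg a \<equiv> inv\<^bsub>A\<^esub> a"
abbreviation rec where "rec a \<equiv> inv\<^bsub>M\<^esub> a"

definition lam where "lam a b = neg a \<boxplus> (a \<star> b)"

lemma mul_closed [simp]: "a \<in> B \<Longrightarrow> b \<in> B \<Longrightarrow> a \<star> b \<in> B"
  using mul.m_closed carrier_eq by simp

lemma rec_closed [simp]: "a \<in> B \<Longrightarrow> rec a \<in> B"
  using mul.inv_closed carrier_eq by simp

lemma add_cancel [simp]: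
  "a \<in> B \<Longrightarrow> b \<in> B \<Longrightarrow> neg a \<boxplus> (a \<boxplus> b) = b" "a \<in> B \<Longrightarrow> b \<in> B \<Longrightarrow> a \<boxplus> (neg a \<boxplus> b) = b"
  by (simp_all flip: add.m_assoc)

lemma mul_cancel [simp]:
  "a \<in> B \<Longrightarrow> b \<in> B \<Longrightarrow> rec a \<star> (a \<star> b) = b" "a \<in> B \<Longrightarrow> b \<in> B \<Longrightarrow> a \<star> (rec a \<star> b) = b"
  by (simp_all add: carrier_eq flip: mul.m_assoc)

lemma mul_assoc: "a \<in> B \<Longrightarrow> b \<in> B \<Longrightarrow> c \<in> B \<Longrightarrow> a \<star> b \<star> c = a \<star> (b \<star> c)"
  using mul.m_assoc carrier_eq by simp

lemma add_telescope: "a \<in> B \<Longrightarrow> b \<in> B \<Longrightarrow> c \<in> B \<Longrightarrow> neg a \<boxplus> c = (neg a \<boxplus> b) \<boxplus> (neg b \<boxplus> c)"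
  by (simp add: add.m_assoc)

lemma one_one: "\<one>\<^bsub>M\<^esub> = \<one>\<^bsub>A\<^esub>"
proof -
  have "\<one>\<^bsub>M\<^esub> \<in> B" using carrier_eq mul.one_closed by simp
  moreover from this have "\<one>\<^bsub>M\<^esub> \<boxplus> \<one>\<^bsub>M\<^esub> \<boxplus> \<one>\<^bsub>M\<^esub> = \<one>\<^bsub>M\<^esub> \<boxplus> \<one>\<^bsub>M\<^esub>"
    using brace_distrib[of "\<one>\<^bsub>M\<^esub>" "\<one>\<^bsub>M\<^esub>" "\<one>\<^bsub>M\<^esub>"] carrier_eq by simp
  ultimately show ?thesis by (metis add.l_cancel_one add.m_closed)
qed

lemma mul_one [simp]: "a \<in> B \<Longrightarrow> \<one>\<^bsub>A\<^esub> \<star> a = a" "a \<in> B \<Longrightarrow> a \<star> \<one>\<^bsub>A\<^esub> = a"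
  "a \<in> B \<Longrightarrow> rec a \<star> a = \<one>\<^bsub>A\<^esub>" "a \<in> B \<Longrightarrow> a \<star> rec a = \<one>\<^bsub>A\<^esub>"
  using carrier_eq by (simp_all flip: one_one)

lemma lam_closed [simp]: "a \<in> B \<Longrightarrow> b \<in> B \<Longrightarrow> lam a b \<in> B"
  by (simp add: lam_def)

lemma mul_eq: "a \<in> B \<Longrightarrow> b \<in> B \<Longrightarrow> a \<star> b = a \<boxplus> lam a b"
  by (simp add: lam_def)

lemma lam_add:
  assumes "a \<in> B" "b \<in> B" "c \<in> B" shows "lam a (b \<boxplus> c) = lam a b \<boxplus> lam a c"
proof -
  have "a \<star> (b \<boxplus> c) = (a \<star> (b \<boxplus> c) \<boxplus> a) \<boxplus> neg a" using assms by (simp add: add.m_assoc)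
  also have "\<dots> = (a \<star> b) \<boxplus> (a \<star> c) \<boxplus> neg a" using assms by (simp add: brace_distrib)
  finally show ?thesis unfolding lam_def using assms by (simp add: add.m_ac)
qed

lemma lam_mul:
  assumes "a \<in> B" "b \<in> B" "c \<in> B" shows "lam (a \<star> b) c = lam a (lam b c)"
proof -
  have "a \<star> b \<boxplus> lam (a \<star> b) c = a \<star> (b \<star> c)"
    using assms by (simp add: mul_assoc flip: mul_eq)
  also have "\<dots> = a \<boxplus> lam a (b \<boxplus> lam b c)"
    using assms by (simp add: mul_eq)
  also have "\<dots> = a \<star> b \<boxplus> lam a (lam b c)"
    using assms by (simp add: lam_add mul_eq add.m_assoc)
  finally show ?thesis using assms by simp
qed

lemma lam_one [simp]: "b \<in> B \<Longrightarrow> lam \<one>\<^bsub>A\<^esub> b = b"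
  by (simp add: lam_def)

lemma lam_rec [simp]:
  "a \<in> B \<Longrightarrow> b \<in> B \<Longrightarrow> lam (rec a) (lam a b) = b" "a \<in> B \<Longrightarrow> b \<in> B \<Longrightarrow> lam a (lam (rec a) b) = b"
  by (simp_all flip: lam_mul)

lemma lam_hom: "a \<in> B \<Longrightarrow> group_hom A A (lam a)"
  by unfold_locales (simp add: hom_def lam_add)

lemma lam_zero [simp]: "a \<in> B \<Longrightarrow> lam a \<one>\<^bsub>A\<^esub> = \<one>\<^bsub>A\<^esub>"
  using group_hom.hom_one[OF lam_hom] by simp

lemma lam_neg: "a \<in> B \<Longrightarrow> b \<in> B \<Longrightarrow> lam a (neg b) = neg (lam a b)"
  using group_hom.hom_inv[OF lam_hom] by simp

lemma lam_pow: "a \<in> B \<Longrightarrow> b \<in> B \<Longrightarrow> lam a (b [^]\<^bsub>A\<^esub> (n::nat)) = lam a b [^]\<^bsub>A\<^esub> n"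
  using group_hom.hom_nat_pow[OF lam_hom] by simp

lemma lam_rec_self: "a \<in> B \<Longrightarrow> lam a (rec a) = neg a"
  by (simp add: lam_def)

definition left_ideal where
  "left_ideal L \<longleftrightarrow> subgroup L A \<and> (\<forall>a\<in>B. \<forall>x\<in>L. lam a x \<in> L)"

definition braceideal where
  "braceideal I \<longleftrightarrow> I \<lhd> M \<and> (\<forall>a\<in>B. \<forall>x\<in>I. lam a x \<in> I)"

lemma left_ideal_subgroup_mul:
  assumes "left_ideal L" shows "subgroup L M"
proof -
  interpret L: subgroup L A using assms by (simp add: left_ideal_def)
  have lam: "\<And>a x. a \<in> B \<Longrightarrow> x \<in> L \<Longrightarrow> lam a x \<in> L" using assms by (simp add: left_ideal_def)
  show ?thesis
  proof (rule mul.subgroupI)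
    show "L \<subseteq> carrier M" using L.subset carrier_eq by simp
    show "L \<noteq> {}" using L.one_closed by blast
    show "rec a \<in> L" if "a \<in> L" for a
      using that lam[of "rec a" "neg a"] lam_rec_self[of a] by (metis L.m_inv_closed L.mem_carrier lam_rec(1) rec_closed)
    show "a \<star> b \<in> L" if "a \<in> L" "b \<in> L" for a b
      using that lam by (simp add: mul_eq)
  qed
qed

lemma braceideal_left_ideal:
  assumes "braceideal I" shows "left_ideal I"
proof -
  interpret I: normal I M using assms by (simp add: braceideal_def)
  have lam: "\<And>a x. a \<in> B \<Longrightarrow> x \<in> I \<Longrightarrow> lam a x \<in> I" using assms by (simp add: braceideal_def)
  have IB: "\<And>a. a \<in> I \<Longrightarrow> a \<in> B" using I.mem_carrier carrier_eq by simp
  have "subgroup I A"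
  proof (rule add.subgroupI)
    show "I \<subseteq> B" using IB by blast
    show "I \<noteq> {}" using I.one_closed by blast
    show "neg a \<in> I" if "a \<in> I" for a
      using that lam[of a "rec a"] IB by (simp add: lam_rec_self)
    show "a \<boxplus> b \<in> I" if "a \<in> I" "b \<in> I" for a b
    proof -
      have "a \<boxplus> b = a \<star> lam (rec a) b" using that IB by (simp add: mul_eq)
      thus ?thesis using that IB lam by simp
    qed
  qed
  thus ?thesis using lam by (simp add: left_ideal_def)
qed

text \<open>\<open>lam a\<close> maps \<open>rec a \<star> b\<close> to
  \<open>neg a \<boxplus> b\<close>, and \<open>lam (rec a)\<close> maps it back. Congruence modulo
  a left ideal therefore has one meaning for both operations.\<close>

lemma left_ideal_congruent:
  assumes "left_ideal I" "a \<in> B" "b \<in> B"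
  shows "rec a \<star> b \<in> I \<longleftrightarrow> neg a \<boxplus> b \<in> I"
proof -
  have lam: "\<And>a x. a \<in> B \<Longrightarrow> x \<in> I \<Longrightarrow> lam a x \<in> I" using assms by (simp add: left_ideal_def)
  have "neg a \<boxplus> b = lam a (rec a \<star> b)" using assms by (simp add: lam_def)
  moreover have "rec a \<star> b = lam (rec a) (neg a \<boxplus> b)" using assms calculation by simp
  ultimately show ?thesis using lam assms by (metis rec_closed)
qed

text \<open>The preimage in \<open>B\<close> of the socle of \<open>B / I\<close>.\<close>

definition socle_over where
  "socle_over I = {a \<in> B. \<forall>b\<in>B. neg b \<boxplus> lam a b \<in> I}"

context
  fixes I assumes I: "braceideal I"
begin

interpretation I: subgroup I A
  using braceideal_left_ideal[OF I] by (simp add: left_ideal_def)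

lemma lam_mem: "a \<in> B \<Longrightarrow> x \<in> I \<Longrightarrow> lam a x \<in> I"
  using I by (simp add: braceideal_def)

lemma mul_congruent_add:
  assumes "a \<in> socle_over I" "b \<in> B"
  shows "neg (a \<boxplus> b) \<boxplus> a \<star> b \<in> I"
proof -
  have "a \<in> B" "neg b \<boxplus> lam a b \<in> I" using assms by (auto simp: socle_over_def)
  moreover have "neg (a \<boxplus> b) \<boxplus> a \<star> b = neg b \<boxplus> lam a b"
    using assms(2) \<open>a \<in> B\<close> by (simp add: mul_eq add.inv_mult add.m_assoc add.m_lcomm[of _ "neg b"])
  ultimately show ?thesis by simp
qed

text \<open>\<open>a \<star> b\<close> is b plus the image under \<open>lam b\<close> of a conjugate
  of a, which lies in I by normality. Subtracting a, also in I, leaves \<open>lam a b\<close>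
  congruent to b.\<close>

lemma subset_socle_over: "I \<subseteq> socle_over I"
proof
  fix a assume a: "a \<in> I"
  hence aB: "a \<in> B" by simp
  interpret N: normal I M using I by (simp add: braceideal_def)
  have "neg b \<boxplus> lam a b \<in> I" if b: "b \<in> B" for b
  proof -
    have "rec b \<star> a \<star> b \<in> I" using N.inv_op_closed1 b a carrier_eq by simp
    hence "lam b (rec b \<star> a \<star> b) \<in> I" using b lam_mem by simp
    moreover have "neg b \<boxplus> lam a b = neg a \<boxplus> (neg b \<boxplus> a \<star> b)"
      using aB b by (simp add: lam_def add.m_lcomm)
    moreover have "neg b \<boxplus> a \<star> b = lam b (rec b \<star> a \<star> b)"
      using aB b by (simp add: lam_def mul_assoc)
    ultimately show ?thesis using a by simp
  qed
  thus "a \<in> socle_over I" using aB by (simp add: socle_over_def)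
qed

text \<open>Modulo I both products are congruent to a + b = b + a. This supplies the commutator
  hypothesis of \<open>orb_quotient\<close>.\<close>

lemma socle_over_commutator:
  assumes "a \<in> socle_over I" "b \<in> socle_over I"
  shows "rec (b \<star> a) \<star> (a \<star> b) \<in> I"
proof -
  have ab: "a \<in> B" "b \<in> B" using assms by (auto simp: socle_over_def)
  have "neg (neg (b \<boxplus> a) \<boxplus> b \<star> a) \<boxplus> (neg (a \<boxplus> b) \<boxplus> a \<star> b) \<in> I"
    using mul_congruent_add assms ab by simp
  moreover have "neg (neg (b \<boxplus> a) \<boxplus> b \<star> a) \<boxplus> (neg (a \<boxplus> b) \<boxplus> a \<star> b) = neg (b \<star> a) \<boxplus> a \<star> b"
  proof -
    have "neg (neg (b \<boxplus> a) \<boxplus> b \<star> a) = neg (b \<star> a) \<boxplus> (b \<boxplus> a)"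
      using ab by (simp add: add.inv_mult_group)
    hence "neg (neg (b \<boxplus> a) \<boxplus> b \<star> a) = neg (b \<star> a) \<boxplus> (a \<boxplus> b)"
      using ab by (simp add: add.m_comm[of b a])
    thus ?thesis using ab by (simp add: add.m_assoc[of "neg (b \<star> a)"])
  qed
  ultimately show ?thesis
    using left_ideal_congruent[OF braceideal_left_ideal[OF I]] ab by simp
qed

text \<open>For the conjugate a', the equation a' g = g a reads a' + \<open>lam a' g\<close> = g +
  \<open>lam g a\<close>, and \<open>lam a' g\<close> is congruent to g. On the socle modulo I,
  conjugation and \<open>lam\<close> thus induce the same action, so invariance under either one
  gives invariance under the other.\<close>

lemma conj_congruent_lam:
  assumes a: "g \<star> a \<star> rec g \<in> socle_over I" and g: "g \<in> B" "a \<in> B"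
  shows "neg (g \<star> a \<star> rec g) \<boxplus> lam g a \<in> I"
proof -
  define a' where "a' = g \<star> a \<star> rec g"
  have a': "a' \<in> B" using g by (simp add: a'_def)
  have eq: "a' \<star> g = g \<star> a" using g by (simp add: a'_def mul_assoc)
  have "neg a' \<boxplus> lam g a = neg g \<boxplus> (neg a' \<boxplus> (g \<boxplus> lam g a))"
    using g a' by (simp add: add.m_lcomm[of "neg g"])
  also have "g \<boxplus> lam g a = a' \<boxplus> lam a' g"
    using g a' eq by (metis mul_eq)
  also have "neg g \<boxplus> (neg a' \<boxplus> (a' \<boxplus> lam a' g)) = neg g \<boxplus> lam a' g"
    using g a' by simp
  finally show ?thesis using a g by (auto simp: a'_def socle_over_def)
qed

lemma braceideal_socle_over: "braceideal (socle_over I)"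
proof -
  let ?J = "socle_over I"
  have JB: "\<And>a. a \<in> ?J \<Longrightarrow> a \<in> B" by (simp add: socle_over_def)
  have J: "subgroup ?J M"
  proof (rule mul.subgroupI)
    show "?J \<subseteq> carrier M" using JB carrier_eq by auto
    show "?J \<noteq> {}" using subset_socle_over I.one_closed by blast
    show "rec a \<in> ?J" if "a \<in> ?J" for a
    proof -
      have "neg b \<boxplus> lam (rec a) b \<in> I" if b: "b \<in> B" for b
      proof -
        have "\<forall>c\<in>B. neg c \<boxplus> lam a c \<in> I"
          using \<open>a \<in> ?J\<close> by (simp add: socle_over_def)
        from bspec[OF this, of "lam (rec a) b"]
        have "neg (neg (lam (rec a) b) \<boxplus> b) \<in> I" using b JB \<open>a \<in> ?J\<close> by simp
        thus ?thesis using b JB \<open>a \<in> ?J\<close> by (simp add: add.inv_mult_group)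
      qed
      thus ?thesis using JB[OF that] by (simp add: socle_over_def)
    qed
    show "a \<star> c \<in> ?J" if "a \<in> ?J" "c \<in> ?J" for a c
    proof -
      have "neg b \<boxplus> lam (a \<star> c) b \<in> I" if b: "b \<in> B" for b
      proof -
        have "(neg b \<boxplus> lam c b) \<boxplus> (neg (lam c b) \<boxplus> lam a (lam c b)) \<in> I"
          by (rule I.m_closed) (use b \<open>a \<in> ?J\<close> \<open>c \<in> ?J\<close> in \<open>simp_all add: socle_over_def\<close>)
        thus ?thesis using b JB \<open>a \<in> ?J\<close> \<open>c \<in> ?J\<close> by (simp add: lam_mul flip: add_telescope)
      qed
      thus ?thesis using JB[OF that(1)] JB[OF that(2)] by (simp add: socle_over_def)
    qed
  qed
  interpret J: subgroup ?J M by (rule J)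
  \<comment> \<open>\<open>lam\<close> of a conjugate is the conjugate of \<open>lam a\<close>, and
    \<open>lam a\<close> is trivial modulo I.\<close>
  have conj: "g \<star> a \<star> rec g \<in> ?J" if a: "a \<in> ?J" and g: "g \<in> B" for a g
  proof -
    have "neg b \<boxplus> lam (g \<star> a \<star> rec g) b \<in> I" if b: "b \<in> B" for b
    proof -
      have "lam g (neg (lam (rec g) b) \<boxplus> lam a (lam (rec g) b)) \<in> I"
        using b g a by (intro lam_mem) (simp_all add: socle_over_def)
      thus ?thesis using b g a JB by (simp add: lam_mul lam_add lam_neg)
    qed
    thus ?thesis using JB[OF a] g by (simp add: socle_over_def)
  qed
  have "lam g a \<in> ?J" if a: "a \<in> ?J" and g: "g \<in> B" for a g
  proof -
    have "neg (g \<star> a \<star> rec g) \<boxplus> lam g a \<in> I"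
      using conj_congruent_lam conj a g JB by simp
    hence "rec (g \<star> a \<star> rec g) \<star> lam g a \<in> ?J"
      using left_ideal_congruent[OF braceideal_left_ideal[OF I]] subset_socle_over g a JB by auto
    hence "(g \<star> a \<star> rec g) \<star> (rec (g \<star> a \<star> rec g) \<star> lam g a) \<in> ?J"
      using conj[OF a g] by simp
    thus ?thesis using g a JB by simp
  qed
  moreover have "?J \<lhd> M"
    by (rule mul.normal_invI[OF J]) (use conj carrier_eq in auto)
  ultimately show ?thesis by (simp add: braceideal_def)
qed

text \<open>Inside the socle modulo I a conjugate of a differs from \<open>lam g a\<close> by an
  element of I, so invariance under \<open>lam\<close> forces normality. This makes the partial
  products of Sylow subgroups ideals when they are not terms of the socle series.\<close>

lemma braceideal_between:
  assumes L: "left_ideal L" "I \<subseteq> L" "L \<subseteq> socle_over I"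
  shows "braceideal L"
proof -
  interpret L: subgroup L A using L by (simp add: left_ideal_def)
  have lam: "\<And>a x. a \<in> B \<Longrightarrow> x \<in> L \<Longrightarrow> lam a x \<in> L" using L by (simp add: left_ideal_def)
  have conj: "g \<star> a \<star> rec g \<in> L" if a: "a \<in> L" and g: "g \<in> B" for a g
  proof -
    have aB: "a \<in> B" using a by simp
    interpret J: normal "socle_over I" M using braceideal_socle_over by (simp add: braceideal_def)
    define a' where "a' = g \<star> a \<star> rec g"
    have "a' \<in> socle_over I"
      using J.inv_op_closed2 a g L carrier_eq by (auto simp: a'_def)
    hence "neg a' \<boxplus> lam g a \<in> L"
      using conj_congruent_lam[of g a] aB g L by (auto simp: a'_def)
    hence "neg (neg a' \<boxplus> lam g a) \<in> L" by simp
    hence "lam g a \<boxplus> neg (neg a' \<boxplus> lam g a) \<in> L" using lam a g by simp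
    moreover have "lam g a \<boxplus> neg (neg a' \<boxplus> lam g a) = a'"
      using g aB by (simp add: add.inv_mult_group a'_def)
    ultimately show ?thesis by (simp add: a'_def)
  qed
  have "L \<lhd> M"
    by (rule mul.normal_invI[OF left_ideal_subgroup_mul[OF L(1)]]) (use conj carrier_eq in auto)
  thus ?thesis using lam by (simp add: braceideal_def)
qed

end

section \<open>Socle series, Hall subgroups and products of left ideals\<close>

primrec socle_series where
  "socle_series 0 = {\<one>\<^bsub>A\<^esub>}"
| "socle_series (Suc k) = socle_over (socle_series k)"

lemma braceideal_trivial: "braceideal {\<one>\<^bsub>A\<^esub>}"
  using mul.one_is_normal by (simp add: braceideal_def one_one)

lemma braceideal_socle_series: "braceideal (socle_series k)"
  by (induction k) (simp_all add: braceideal_trivial braceideal_socle_over)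

lemma left_ideal_socle_series: "left_ideal (socle_series k)"
  by (simp add: braceideal_socle_series braceideal_left_ideal)

lemma socle_series_mono: "i \<le> j \<Longrightarrow> socle_series i \<subseteq> socle_series j"
  by (rule lift_Suc_mono_le[of socle_series]) (simp_all add: subset_socle_over braceideal_socle_series)

text \<open>A subgroup of an abelian group with order prime to its index consists of all elements
  killed by its order, so each automorphism \<open>lam a\<close> preserves it.\<close>

lemma left_ideal_hall:
  assumes "finite B" "subgroup L A" "coprime (card L) (order A div card L)"
  shows "left_ideal L"
proof -
  have "lam a x \<in> L" if a: "a \<in> B" and x: "x \<in> L" for a x
  proof (rule add.coprime_pow_mem[OF assms(2) _ _ _ assms(3)])
    have xB: "x \<in> B" using x assms(2) subgroup.mem_carrier by metis
    show "lam a x \<in> B" using a xB by simp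
    have "lam a x [^]\<^bsub>A\<^esub> card L = \<one>\<^bsub>A\<^esub>"
      using add.pow_card_subgroup[OF assms(2) x] lam_pow[OF a xB, of "card L", symmetric] a by simp
    thus "lam a x [^]\<^bsub>A\<^esub> card L \<in> L" using subgroup.one_closed[OF assms(2)] by simp
    show "lam a x [^]\<^bsub>A\<^esub> (order A div card L) \<in> L"
      using add.pow_index_mem[OF add.subgroup_imp_normal[OF assms(2)] assms(1)] a xB by simp
  qed
  thus ?thesis using assms(2) by (simp add: left_ideal_def)
qed

text \<open>The product of h and k is h + \<open>lam h k\<close>, and \<open>lam h\<close> permutes
  K. Products of left ideals become sums in an abelian group.\<close>

lemma set_mult_left_ideal:
  assumes "left_ideal L" "left_ideal K"
  shows "L <#>\<^bsub>M\<^esub> K = L <#>\<^bsub>A\<^esub> K"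
proof -
  interpret L: subgroup L A using assms by (simp add: left_ideal_def)
  interpret K: subgroup K A using assms by (simp add: left_ideal_def)
  have lam: "\<And>a x. a \<in> B \<Longrightarrow> x \<in> K \<Longrightarrow> lam a x \<in> K" using assms by (simp add: left_ideal_def)
  have "\<exists>k'\<in>K. h \<star> k = h \<boxplus> k'" if "h \<in> L" "k \<in> K" for h k
    using that lam by (intro bexI[of _ "lam h k"]) (simp_all add: mul_eq)
  moreover have "\<exists>k'\<in>K. h \<boxplus> k = h \<star> k'" if "h \<in> L" "k \<in> K" for h k
    using that lam by (intro bexI[of _ "lam (rec h) k"]) (simp_all add: mul_eq)
  ultimately show ?thesis by (auto simp: set_mult_def)
qed

lemma left_ideal_set_mult:
  assumes "left_ideal L" "left_ideal K"
  shows "left_ideal (L <#>\<^bsub>A\<^esub> K)"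
proof -
  have "subgroup (L <#>\<^bsub>A\<^esub> K) A"
    using assms add.mult_subgroups by (simp add: left_ideal_def)
  moreover have "lam a (h \<boxplus> k) \<in> L <#>\<^bsub>A\<^esub> K" if "a \<in> B" "h \<in> L" "k \<in> K" for a h k
  proof -
    have "h \<in> B" "k \<in> B" using that assms by (auto simp: left_ideal_def dest: subgroup.mem_carrier)
    hence "lam a (h \<boxplus> k) = lam a h \<boxplus> lam a k" using that by (simp add: lam_add)
    moreover have "lam a h \<in> L" "lam a k \<in> K" using that assms by (simp_all add: left_ideal_def)
    ultimately show ?thesis by (auto simp: set_mult_def)
  qed
  ultimately show ?thesis by (auto simp: left_ideal_def set_mult_def)
qed

primrec iterated_prod where
  "iterated_prod Q 0 = {\<one>\<^bsub>M\<^esub>}"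
| "iterated_prod Q (Suc k) = iterated_prod Q k <#>\<^bsub>M\<^esub> Q k"

lemma left_ideal_iterated_prod:
  "(\<And>l. l < k \<Longrightarrow> left_ideal (Q l)) \<Longrightarrow> left_ideal (iterated_prod Q k)"
proof (induction k)
  case 0
  show ?case using braceideal_left_ideal[OF braceideal_trivial] by (simp add: one_one)
next
  case (Suc k)
  thus ?case by (simp add: set_mult_left_ideal left_ideal_set_mult)
qed

lemma iterated_prod_Suc:
  assumes "\<And>l. l < Suc k \<Longrightarrow> left_ideal (Q l)"
  shows "iterated_prod Q (Suc k) = iterated_prod Q k <#>\<^bsub>A\<^esub> Q k"
  using assms left_ideal_iterated_prod[of k Q] set_mult_left_ideal by simp

lemma subset_set_mult:
  assumes "left_ideal L" "left_ideal K"
  shows "L \<subseteq> L <#>\<^bsub>A\<^esub> K" "K \<subseteq> L <#>\<^bsub>A\<^esub> K"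
proof -
  interpret L: subgroup L A using assms by (simp add: left_ideal_def)
  interpret K: subgroup K A using assms by (simp add: left_ideal_def)
  show "L \<subseteq> L <#>\<^bsub>A\<^esub> K"
  proof
    fix x assume "x \<in> L"
    thus "x \<in> L <#>\<^bsub>A\<^esub> K" unfolding set_mult_def using K.one_closed L.mem_carrier[of x]
      by (intro UN_I[of x] UN_I[of "\<one>\<^bsub>A\<^esub>"]) auto
  qed
  show "K \<subseteq> L <#>\<^bsub>A\<^esub> K"
  proof
    fix x assume "x \<in> K"
    thus "x \<in> L <#>\<^bsub>A\<^esub> K" unfolding set_mult_def using L.one_closed K.mem_carrier[of x]
      by (intro UN_I[of x] UN_I[of "\<one>\<^bsub>A\<^esub>"]) auto
  qed
qed

lemma iterated_prod_mono:
  assumes "\<And>l. l < k \<Longrightarrow> left_ideal (Q l)" "l < k"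
  shows "Q l \<subseteq> iterated_prod Q k"
  using assms
proof (induction k)
  case (Suc k)
  have "left_ideal (iterated_prod Q k)" using Suc.prems by (intro left_ideal_iterated_prod) simp
  note sub = subset_set_mult[OF this, of "Q k"]
  show ?case
  proof (cases "l = k")
    case True
    thus ?thesis using sub Suc.prems iterated_prod_Suc[of k Q] by simp
  next
    case False
    hence "Q l \<subseteq> iterated_prod Q k" using Suc by simp
    thus ?thesis using sub Suc.prems iterated_prod_Suc[of k Q] by auto
  qed
qed simp

lemma iterated_prod_least:
  assumes "left_ideal L" "\<And>l. l < k \<Longrightarrow> Q l \<subseteq> L"
  shows "iterated_prod Q k \<subseteq> L"
proof -
  interpret L: subgroup L M by (rule left_ideal_subgroup_mul[OF assms(1)])
  show ?thesis using assms(2)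
  proof (induction k)
    case (Suc k)
    hence "iterated_prod Q k \<subseteq> L" "Q k \<subseteq> L" by simp_all
    thus ?case by (auto simp: set_mult_def)
  qed simp
qed

text \<open>In the abelian additive group h + l is killed by the product of the two subgroup orders,
  so by Cauchy's theorem no new prime appears.\<close>

lemma prime_dvd_card_iterated_prod:
  assumes fin: "finite B" and q: "Factorial_Ring.prime q"
  shows "\<lbrakk>\<And>l. l < k \<Longrightarrow> left_ideal (Q l); q dvd card (iterated_prod Q k)\<rbrakk> \<Longrightarrow> \<exists>l<k. q dvd card (Q l)"
proof (induction k)
  case 0
  thus ?case using q by (auto simp: not_prime_unit)
next
  case (Suc k)
  let ?H = "iterated_prod Q k" and ?K = "Q k"
  have H: "left_ideal ?H" and K: "left_ideal ?K"
    using Suc.prems by (simp_all add: left_ideal_iterated_prod)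
  have H': "subgroup ?H A" and K': "subgroup ?K A" using H K by (simp_all add: left_ideal_def)
  have HK: "subgroup (?H <#>\<^bsub>A\<^esub> ?K) A" using left_ideal_set_mult[OF H K] by (simp add: left_ideal_def)
  have "q dvd card ?H * card ?K"
  proof (rule add.prime_dvd_card_subgroup[OF fin HK q])
    show "q dvd card (?H <#>\<^bsub>A\<^esub> ?K)" using Suc.prems by (simp flip: set_mult_left_ideal[OF H K])
    fix x assume "x \<in> ?H <#>\<^bsub>A\<^esub> ?K"
    then obtain h l where hl: "h \<in> ?H" "l \<in> ?K" "x = h \<boxplus> l" by (auto simp: set_mult_def)
    have B: "h \<in> B" "l \<in> B" using hl H' K' by (auto dest: subgroup.mem_carrier)
    have "h [^]\<^bsub>A\<^esub> (card ?H * card ?K) = \<one>\<^bsub>A\<^esub>"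
      using add.pow_card_subgroup[OF H' hl(1)] B by (simp flip: add.nat_pow_pow)
    moreover have "l [^]\<^bsub>A\<^esub> (card ?H * card ?K) = \<one>\<^bsub>A\<^esub>"
      using add.pow_card_subgroup[OF K' hl(2)] B by (simp add: mult.commute[of "card ?H"] flip: add.nat_pow_pow)
    ultimately show "x [^]\<^bsub>A\<^esub> (card ?H * card ?K) = \<one>\<^bsub>A\<^esub>"
      using hl B by (simp add: add.nat_pow_distrib)
  qed
  hence "q dvd card ?H \<or> q dvd card ?K" using q prime_dvd_mult_iff by blast
  thus ?case using Suc by (meson less_SucI lessI)
qed

end

section \<open>Braces acting transitively on a set of squarefree size\<close>

lemma squarefree_mult_no_common_prime:
  fixes m n q :: nat
  assumes "squarefree (m * n)" "Factorial_Ring.prime q" "q dvd m" "q dvd n"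
  shows False
proof -
  have "q ^ 2 dvd m * n" using assms(3,4) by (simp add: power2_eq_square mult_dvd_mono)
  hence "q dvd 1" using assms(1) squarefreeD by blast
  thus False using assms(2) not_prime_unit by blast
qed

lemma ex_sorting_permutation:
  fixes f :: "nat \<Rightarrow> nat"
  obtains \<tau> where "\<tau> permutes {..<n}" "\<And>i j. i \<le> j \<Longrightarrow> j < n \<Longrightarrow> f (\<tau> i) \<le> f (\<tau> j)"
proof -
  define xs where "xs = sort_key f [0..<n]"
  define \<tau> where "\<tau> = (\<lambda>i. if i < n then xs ! i else i)"
  have xs: "length xs = n" "set xs = {..<n}" "distinct xs" "sorted (map f xs)"
    by (auto simp: xs_def)
  have "bij_betw ((!) xs) {..<n} {..<n}"
    using bij_betw_nth[OF xs(3)] xs by simp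
  moreover have "bij_betw ((!) xs) {..<n} {..<n} \<longleftrightarrow> bij_betw \<tau> {..<n} {..<n}"
    by (rule bij_betw_cong) (simp add: \<tau>_def)
  ultimately have "bij_betw \<tau> {..<n} {..<n}" by blast
  hence "\<tau> permutes {..<n}"
    by (rule bij_imp_permutes) (simp add: \<tau>_def)
  moreover have "f (\<tau> i) \<le> f (\<tau> j)" if "i \<le> j" "j < n" for i j
    using sorted_nth_mono[OF xs(4), of i j] that xs(1) by (simp add: \<tau>_def)
  ultimately show thesis by (rule that)
qed

text \<open>All that the arithmetic takes from a solution. \<open>saturated\<close> makes N_k the
  full kernel of the action on its own orbits; for a solution, this and the exhaustion of B come
  from the retracts.\<close>

locale transitive_brace = left_brace A M + perm: perm_group M
  for A :: "('a::finite \<Rightarrow> 'a, 'c) monoid_scheme" and M :: "('a \<Rightarrow> 'a, 'd) monoid_scheme" +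
  assumes transitive: "\<exists>g\<in>carrier M. g x = y"
    and saturated: "\<lbrakk>g \<in> carrier M; \<And>x. g x \<in> perm.orb (socle_series k) x\<rbrakk> \<Longrightarrow> g \<in> socle_series k"
    and socle_series_exhausts: "\<exists>k. socle_series k = carrier M"
    and squarefree_degree: "squarefree (card (UNIV :: 'a set))"
begin

section \<open>Orbit sizes along the socle series\<close>

abbreviation N where "N \<equiv> socle_series"

lemma N_normal: "N k \<lhd> M"
  using braceideal_socle_series[of k] by (simp add: braceideal_def)

lemma N_subgroup: "subgroup (N k) M" "subgroup (N k) A"
  using left_ideal_socle_series[of k] left_ideal_subgroup_mul by (auto simp: left_ideal_def)

lemma N_closed: "g \<in> N k \<Longrightarrow> g \<in> B"
  using N_subgroup(2) by (rule subgroup.mem_carrier)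

lemma N_normal_add: "N k \<lhd> A"
  by (rule add.subgroup_imp_normal[OF N_subgroup(2)])

text \<open>The base point is arbitrary: under a transitive group all orbits of a normal subgroup
  have the same size.\<close>

definition D where "D k = card (perm.orb (N k) undefined)"

lemma card_orb_N: "card (perm.orb (N k) x) = D k"
  using transitive[of undefined x] perm.card_orb_normal[OF N_normal] unfolding D_def by metis

lemma one_id: "\<one>\<^bsub>A\<^esub> = id" "\<one>\<^bsub>M\<^esub> = id"
  using perm.one_eq one_one by simp_all

lemma D_0: "D 0 = 1"
  by (simp add: D_def perm.orb_def)

lemma orb_B: "perm.orb B x = UNIV"
proof -
  have "y \<in> perm.orb B x" for y
    using transitive[of x y] unfolding perm.orb_def carrier_eq by blast
  thus ?thesis by blast
qed

lemma D_exhausted: "N k = B \<Longrightarrow> D k = card (UNIV :: 'a set)"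
  by (simp add: D_def orb_B)

text \<open>The exponent given by \<open>orb_quotient\<close> is the same at every x because the
  orbit sizes are. The power therefore preserves all N_k-orbits at once, and saturation puts it into
  N_k.\<close>

lemma
  shows D_Suc_dvd: "D k dvd D (Suc k)"
    and pow_mem_N: "g \<in> N (Suc k) \<Longrightarrow> g [^]\<^bsub>M\<^esub> (D (Suc k) div D k) \<in> N k"
proof -
  have comm: "rec (b \<star> a) \<star> (a \<star> b) \<in> N k" if "a \<in> N (Suc k)" "b \<in> N (Suc k)" for a b
    using socle_over_commutator[OF braceideal_socle_series] that by simp
  note q = perm.orb_quotient[OF N_subgroup(1) N_normal socle_series_mono[OF le_SucI[OF order_refl]] comm, unfolded card_orb_N]
  show "D k dvd D (Suc k)" by (rule q(1)) 
  assume g: "g \<in> N (Suc k)"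
  show "g [^]\<^bsub>M\<^esub> (D (Suc k) div D k) \<in> N k"
    by (rule saturated[OF mul.nat_pow_closed q(2)[OF _ _ g]]) (use N_closed[OF g] carrier_eq in auto)
qed

lemma D_dvd: "i \<le> j \<Longrightarrow> D i dvd D j"
  by (induction j rule: dec_induct) (auto intro: dvd_trans D_Suc_dvd)

lemma D_pos: "D k > 0"
  by (simp add: D_def perm.orb_def card_gt_0_iff) (use subgroup.one_closed[OF N_subgroup(1)] in blast)

lemma pow_mem_N_le: "i \<le> j \<Longrightarrow> g \<in> N j \<Longrightarrow> g [^]\<^bsub>M\<^esub> (D j div D i) \<in> N i"
proof (induction j arbitrary: g rule: dec_induct)
  case base
  thus ?case using D_pos[of i] N_closed carrier_eq by simp
next
  case (step j)
  have "D (Suc j) div D i = (D (Suc j) div D j) * (D j div D i)"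
    using D_dvd[OF step.hyps(1)] D_Suc_dvd[of j] D_pos[of i] D_pos[of j]
    by (elim dvdE) simp
  moreover have "g \<in> carrier M" using N_closed[OF step.prems] carrier_eq by simp
  ultimately show ?case using step.IH[OF pow_mem_N[OF step.prems]] by (simp add: mul.nat_pow_pow)
qed

definition height where "height = (SOME k. N k = B)"

lemma N_height: "N height = B"
proof -
  obtain k where "N k = B" using socle_series_exhausts carrier_eq by auto
  thus ?thesis unfolding height_def by (rule someI)
qed

lemma D_height: "D height = card (UNIV :: 'a set)"
  by (rule D_exhausted[OF N_height])

lemma N_above: "height \<le> k \<Longrightarrow> N k = B"
  using socle_series_mono[of height k] N_height N_closed by blast

lemma D_dvd_degree: "D k dvd card (UNIV :: 'a set)"
  using D_dvd[of k height] D_dvd[of height k] D_height D_exhausted[OF N_above, of k]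
  by (cases "k \<le> height") auto

lemma finite_B: "finite B"
  by simp

lemma finite_carrier_M: "finite (carrier M)"
  by simp

lemma prime_dvd_card_N:
  assumes "Factorial_Ring.prime q" "q dvd card (N k)" shows "q dvd D k"
proof (rule mul.prime_dvd_card_subgroup[OF finite_carrier_M N_subgroup(1) assms])
  fix g assume "g \<in> N k"
  \<comment> \<open>At index 0 the term N_0 is trivial and D_0 = 1, so the exponent is D_k
    itself.\<close>
  from pow_mem_N_le[OF _ this, of 0] show "g [^]\<^bsub>M\<^esub> D k = \<one>\<^bsub>M\<^esub>"
    by (simp add: D_0 one_one)
qed

lemma order_M: "order M = order A"
  by (simp add: order_def carrier_eq)

lemma prime_dvd_index_N:
  assumes "Factorial_Ring.prime q" "q dvd order A div card (N k)"
  shows "q dvd card (UNIV :: 'a set) div D k"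
proof (rule mul.prime_dvd_index[OF finite_carrier_M N_normal assms(1), folded order_M])
  show "q dvd order M div card (N k)" using assms(2) by (simp add: order_M)
  fix g assume g: "g \<in> carrier M"
  show "g [^]\<^bsub>M\<^esub> (card (UNIV :: 'a set) div D k) \<in> N k"
  proof (cases "k \<le> height")
    case True
    thus ?thesis using pow_mem_N_le[OF True, of g] g N_height D_height carrier_eq by simp
  next
    case False
    thus ?thesis using N_above[of k] mul.nat_pow_closed[OF g] carrier_eq by simp
  qed
qed

text \<open>D_k and its cofactor in the squarefree degree share no prime. Together with
  \<open>prime_dvd_card_N\<close> this is the Hall property of N_k.\<close>

lemma prime_not_dvd_index_N:
  assumes "Factorial_Ring.prime q" "q dvd D k" shows "\<not> q dvd order A div card (N k)"
proof
  assume "q dvd order A div card (N k)"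
  hence "q dvd card (UNIV :: 'a set) div D k" by (rule prime_dvd_index_N[OF assms(1)])
  moreover have "D k * (card (UNIV :: 'a set) div D k) = card (UNIV :: 'a set)"
    using D_dvd_degree by simp
  ultimately show False
    using squarefree_mult_no_common_prime[of "D k" "card (UNIV :: 'a set) div D k" q] assms squarefree_degree by simp
qed

lemma N_subset_of_primes:
  assumes "subgroup H A" "\<And>q. Factorial_Ring.prime q \<Longrightarrow> q dvd card H \<Longrightarrow> q dvd D k"
  shows "H \<subseteq> N k"
  by (rule add.subgroup_le_of_coprime_index[OF finite_B assms(1) N_normal_add])
    (use assms(2) prime_not_dvd_index_N in \<open>blast intro: coprime_of_no_common_prime\<close>)

text \<open>One direction is the exponent bound at the top of the series, the other is
  orbit-stabilizer for the transitive action.\<close>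

lemma prime_dvd_order:
  assumes "Factorial_Ring.prime q" shows "q dvd order A \<longleftrightarrow> q dvd card (UNIV :: 'a set)"
proof
  assume "q dvd order A"
  thus "q dvd card (UNIV :: 'a set)"
    using prime_dvd_card_N[of q height] assms N_height D_height by (simp add: order_def)
next
  assume "q dvd card (UNIV :: 'a set)"
  moreover have "{g \<in> B. g undefined \<in> UNIV} = B" by simp
  ultimately show "q dvd order A"
    using perm.card_transporter[OF mul.subgroup_self, of UNIV undefined] carrier_eq orb_B
    by (simp add: order_def)
qed

text \<open>Meaningful for primes dividing the degree. For these it is also the first k at which N_k
  contains the Sylow subgroup.\<close>

definition level where "level q = (LEAST k. q dvd D k)"

lemma level:
  assumes "q dvd card (UNIV :: 'a set)" "Factorial_Ring.prime q"
  shows "q dvd D k \<longleftrightarrow> level q \<le> k" and "0 < level q"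
proof -
  have ex: "q dvd D height" using assms by (simp add: D_height)
  show *: "q dvd D k \<longleftrightarrow> level q \<le> k" for k
    using LeastI[of "\<lambda>k. q dvd D k", OF ex] Least_le[of "\<lambda>k. q dvd D k" k] D_dvd[of "level q" k]
    unfolding level_def by (meson dvd_trans)
  show "0 < level q" using *[of 0] assms D_0 not_prime_unit[of q] by (cases "level q") auto
qed

lemma soc_eq: "N 1 = {a \<in> B. \<forall>b\<in>B. a \<star> b = a \<boxplus> b}"
proof -
  have "neg b \<boxplus> lam a b = \<one>\<^bsub>A\<^esub> \<longleftrightarrow> a \<star> b = a \<boxplus> b" if "a \<in> B" "b \<in> B" for a b
    using that by (metis add.l_cancel add.l_inv add.inv_closed lam_closed mul_eq)
  thus ?thesis by (auto simp: socle_over_def)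
qed

text \<open>A trivial socle would keep the whole series trivial, so B would be trivial and, being
  transitive, act on a single point.\<close>

lemma ex_level_one:
  assumes "card (UNIV :: 'a set) > 1"
  obtains q where "Factorial_Ring.prime q" "q dvd D 1"
proof -
  have "N 1 \<noteq> {\<one>\<^bsub>A\<^esub>}"
  proof
    assume *: "N 1 = {\<one>\<^bsub>A\<^esub>}"
    have "N k = {\<one>\<^bsub>A\<^esub>}" for k
      using * by (induction k) simp_all
    hence "B = N 0" using N_height by simp
    hence "card (UNIV :: 'a set) = 1" using D_exhausted[of 0] D_0 by simp
    thus False using assms by simp
  qed
  hence "card (N 1) \<noteq> 1"
    using subgroup.one_closed[OF N_subgroup(2), of 1] by (metis card_1_singletonE singletonD)
  then obtain q where "Factorial_Ring.prime q" "q dvd card (N 1)" by (metis prime_factor_nat)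
  thus thesis using that prime_dvd_card_N by blast
qed

section \<open>Sylow subgroups and the chain of ideals\<close>

context
  fixes n :: nat and p :: "nat \<Rightarrow> nat" and P :: "nat \<Rightarrow> ('a \<Rightarrow> 'a) set"
  assumes p_prime: "i < n \<Longrightarrow> Factorial_Ring.prime (p i)"
    and degree: "card (UNIV :: 'a set) = (\<Prod>i<n. p i)"
    and sylow: "i < n \<Longrightarrow> sylow_subgroup A (p i) (P i)"
begin

lemma prime_dvd_degree_iff:
  assumes "Factorial_Ring.prime q" shows "q dvd card (UNIV :: 'a set) \<longleftrightarrow> (\<exists>i<n. q = p i)"
proof
  assume "q dvd card (UNIV :: 'a set)"
  then obtain i where "i < n" "q dvd p i"
    using assms by (auto simp: degree prime_dvd_prod_iff)
  thus "\<exists>i<n. q = p i" using primes_dvd_imp_eq[OF assms p_prime] by blast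
qed (auto simp: degree)

lemma p_dvd_degree: "i < n \<Longrightarrow> p i dvd card (UNIV :: 'a set)"
  using prime_dvd_degree_iff[OF p_prime] by blast

lemma P_subgroup: "i < n \<Longrightarrow> subgroup (P i) A"
  using sylow by (simp add: sylow_subgroup_def)

lemma prime_dvd_card_P:
  assumes "i < n" "Factorial_Ring.prime q" "q dvd card (P i)" shows "q = p i"
proof -
  have "q dvd p i" using sylow[OF assms(1)] assms prime_dvd_power by (auto simp: sylow_subgroup_def)
  thus ?thesis using primes_dvd_imp_eq[OF assms(2) p_prime[OF assms(1)]] by blast
qed

lemma not_dvd_index:
  assumes "i < n" "subgroup K A" "P i \<subseteq> K" shows "\<not> p i dvd order A div card K"
proof
  assume "p i dvd order A div card K"
  moreover have "card (P i) dvd card K"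
    by (rule add.card_subgroup_dvd_subgroup[OF P_subgroup[OF assms(1)] assms(2,3)])
  ultimately have "card (P i) * p i dvd card K * (order A div card K)"
    by (rule mult_dvd_mono[rotated])
  hence "p i ^ Suc (multiplicity (p i) (order A)) dvd order A"
    using sylow[OF assms(1)] add.card_subgroup_dvd[OF assms(2)] by (simp add: sylow_subgroup_def mult.commute)
  moreover have "order A \<noteq> 0" using add.order_gt_0_iff_finite by simp
  moreover have "\<not> is_unit (p i)" using p_prime[OF assms(1)] not_prime_unit by blast
  ultimately have "Suc (multiplicity (p i) (order A)) \<le> multiplicity (p i) (order A)"
    by (intro multiplicity_geI)
  thus False by simp
qed

lemma P_left_ideal:
  assumes i: "i < n" shows "left_ideal (P i)"
proof (rule left_ideal_hall[OF finite_B P_subgroup[OF i]])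
  show "coprime (card (P i)) (order A div card (P i))"
    using prime_dvd_card_P[OF i] not_dvd_index[OF i P_subgroup[OF i] subset_refl]
    by (blast intro: coprime_of_no_common_prime)
qed

lemma level_p: "i < n \<Longrightarrow> p i dvd D k \<longleftrightarrow> level (p i) \<le> k" "i < n \<Longrightarrow> 0 < level (p i)"
  using level p_dvd_degree p_prime by blast+

lemma P_subset_N:
  assumes "i < n" "level (p i) \<le> k" shows "P i \<subseteq> N k"
  by (rule N_subset_of_primes[OF P_subgroup]) (use assms prime_dvd_card_P level_p in auto)

text \<open>Counterpart of \<open>P_subset_N\<close>: the Hall subgroup N_k either contains P_i or
  meets it trivially, and \<open>level\<close> marks the switch. Below it, congruences modulo N_k
  between elements of P_i are equalities.\<close>

lemma P_inter_N:
  assumes "i < n" "k < level (p i)" "x \<in> P i" "x \<in> N k" shows "x = \<one>\<^bsub>A\<^esub>"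
proof (rule add.inter_trivial_of_coprime_card[OF P_subgroup[OF assms(1)] N_subgroup(2) _ assms(3,4)])
  show "coprime (card (P i)) (card (N k))"
    using prime_dvd_card_P[OF assms(1)] prime_dvd_card_N level_p(1)[OF assms(1), of k] assms(2)
    by (intro coprime_of_no_common_prime) auto
qed

text \<open>At level k + 1 the element a is in the socle modulo N_k, so product and sum agree modulo
  N_k. Their difference also lies in P_i, which meets N_k trivially.\<close>

lemma P_trivial_brace:
  assumes i: "i < n" and ab: "a \<in> P i" "b \<in> P i" shows "a \<star> b = a \<boxplus> b"
proof -
  interpret Pi: subgroup "P i" A by (rule P_subgroup[OF i])
  interpret Pm: subgroup "P i" M by (rule left_ideal_subgroup_mul[OF P_left_ideal[OF i]])
  obtain k where k: "level (p i) = Suc k" using level_p(2)[OF i] by (cases "level (p i)") auto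
  have "a \<in> socle_over (N k)" using P_subset_N[OF i, of "Suc k"] k ab by auto
  hence "neg (a \<boxplus> b) \<boxplus> a \<star> b \<in> N k"
    using mul_congruent_add[OF braceideal_socle_series] ab by simp
  hence "neg (a \<boxplus> b) \<boxplus> a \<star> b = \<one>\<^bsub>A\<^esub>"
    using ab k by (intro P_inter_N[OF i]) auto
  hence "(a \<boxplus> b) \<boxplus> (neg (a \<boxplus> b) \<boxplus> a \<star> b) = a \<boxplus> b" using ab by simp
  thus ?thesis using ab by (simp del: add.inv_mult)
qed

lemma P_elementary:
  assumes i: "i < n" and a: "a \<in> P i" shows "a [^]\<^bsub>A\<^esub> p i = \<one>\<^bsub>A\<^esub>"
proof -
  interpret Pi: subgroup "P i" A by (rule P_subgroup[OF i])
  interpret Pm: subgroup "P i" M by (rule left_ideal_subgroup_mul[OF P_left_ideal[OF i]])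
  obtain k where k: "level (p i) = Suc k" using level_p(2)[OF i] by (cases "level (p i)") auto
  have pow: "a [^]\<^bsub>M\<^esub> m \<in> P i \<and> a [^]\<^bsub>M\<^esub> m = a [^]\<^bsub>A\<^esub> m" for m :: nat
    using a by (induction m) (auto simp: one_one P_trivial_brace[OF i])
  \<comment> \<open>d kills a and divides the squarefree degree, while the order of a is a power of
    \<open>p i\<close>. That order is therefore 1 or \<open>p i\<close>.\<close>
  define d where "d = D (Suc k) div D k"
  have "a [^]\<^bsub>M\<^esub> d \<in> N k"
    unfolding d_def by (rule pow_mem_N) (use P_subset_N[OF i, of "Suc k"] k a in auto)
  hence "a [^]\<^bsub>A\<^esub> d = \<one>\<^bsub>A\<^esub>" using P_inter_N[OF i, of k] pow[of d] k by auto
  hence "add.ord a dvd d" using a by (simp add: add.pow_eq_id)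
  moreover have "d dvd card (UNIV :: 'a set)"
    using D_dvd_degree[of "Suc k"] D_Suc_dvd[of k] unfolding d_def by (metis dvd_mult_div_cancel dvd_triv_right dvd_trans)
  ultimately have ord_d: "add.ord a dvd card (UNIV :: 'a set)" by (rule dvd_trans)
  have "add.ord a dvd card (P i)"
    using add.pow_card_subgroup[OF P_subgroup[OF i] a] a by (simp add: add.pow_eq_id)
  then obtain f where f: "add.ord a = p i ^ f"
    using sylow[OF i] p_prime[OF i] by (auto simp: sylow_subgroup_def divides_primepow_nat)
  have "f \<le> 1"
  proof (rule ccontr)
    assume "\<not> f \<le> 1"
    hence "p i ^ 2 dvd add.ord a" unfolding f by (intro le_imp_power_dvd) simp
    hence "p i ^ 2 dvd card (UNIV :: 'a set)" using ord_d by (rule dvd_trans)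
    thus False using squarefreeD[OF squarefree_degree] p_prime[OF i] not_prime_unit by blast
  qed
  hence "add.ord a dvd p i" unfolding f using le_imp_power_dvd[of f 1 "p i"] by simp
  thus ?thesis using a by (simp add: add.pow_eq_id)
qed

lemma iterated_prod_eq_B:
  assumes "\<tau> permutes {..<n}" shows "iterated_prod (P \<circ> \<tau>) n = B"
proof -
  have \<tau>: "\<tau> l < n" if "l < n" for l using permutes_in_image[OF assms, of l] that by simp
  have ideals: "left_ideal ((P \<circ> \<tau>) l)" if "l < n" for l
    using that \<tau> P_left_ideal by simp
  let ?K = "iterated_prod (P \<circ> \<tau>) n"
  have K: "subgroup ?K A" using left_ideal_iterated_prod[of n "P \<circ> \<tau>"] ideals by (simp add: left_ideal_def)
  have P: "P i \<subseteq> ?K" if "i < n" for i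
  proof -
    obtain l where "l < n" "\<tau> l = i"
      using permutes_image[OF assms] \<open>i < n\<close> by (metis imageE lessThan_iff)
    thus ?thesis using iterated_prod_mono[of n "P \<circ> \<tau>" l] ideals by auto
  qed
  have "B \<subseteq> ?K"
  proof (rule add.subgroup_le_of_coprime_index[OF finite_B add.subgroup_self add.subgroup_imp_normal[OF K]],
      rule coprime_of_no_common_prime)
    fix q assume q: "Factorial_Ring.prime q" "q dvd card B" "q dvd order A div card ?K"
    hence "q dvd card (UNIV :: 'a set)" using prime_dvd_order by (simp add: order_def)
    then obtain i where "i < n" "q = p i" using prime_dvd_degree_iff q(1) by blast
    thus False using not_dvd_index[OF _ K P] q(3) by blast
  qed
  thus ?thesis using subgroup.subset[OF K] by blast
qed

text \<open>The primes are sorted by level. If the prime at position i has level k + 1, the primes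
  dividing D_k have level at most k and stand before i, which puts N_k inside the product of the
  first i factors. All primes up to position i have level at most k + 1, which gives the upper
  bound.\<close>

lemma ex_chain:
  assumes "n > 0"
  obtains \<tau> where "\<tau> permutes {..<n}" "P (\<tau> 0) \<subseteq> N 1"
    "\<And>i. i < n \<Longrightarrow> \<exists>k. N k \<subseteq> iterated_prod (P \<circ> \<tau>) i \<and> iterated_prod (P \<circ> \<tau>) (Suc i) \<subseteq> N (Suc k)"
proof -
  obtain \<tau> where \<tau>: "\<tau> permutes {..<n}"
    and mono: "\<And>i j. i \<le> j \<Longrightarrow> j < n \<Longrightarrow> level (p (\<tau> i)) \<le> level (p (\<tau> j))"
    using ex_sorting_permutation[of n "\<lambda>i. level (p i)"] by metis
  have \<tau>_less: "\<tau> l < n" if "l < n" for l using permutes_in_image[OF \<tau>, of l] that by simp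
  have \<tau>_surj: "\<exists>l<n. \<tau> l = i" if "i < n" for i
    using permutes_image[OF \<tau>] that by (metis imageE lessThan_iff)
  have ideals: "left_ideal ((P \<circ> \<tau>) l)" if "l < n" for l
    using that \<tau>_less P_left_ideal by simp
  have "\<exists>k. N k \<subseteq> iterated_prod (P \<circ> \<tau>) i \<and> iterated_prod (P \<circ> \<tau>) (Suc i) \<subseteq> N (Suc k)"
    if i: "i < n" for i
  proof -
    obtain k where k: "level (p (\<tau> i)) = Suc k"
      using level_p(2)[OF \<tau>_less[OF i]] by (cases "level (p (\<tau> i))") auto
    let ?J = "iterated_prod (P \<circ> \<tau>) i"
    have J: "subgroup ?J A"
      using left_ideal_iterated_prod[of i "P \<circ> \<tau>"] ideals i by (simp add: left_ideal_def)
    have "N k \<subseteq> ?J"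
    proof (rule add.subgroup_le_of_coprime_index[OF finite_B N_subgroup(2) add.subgroup_imp_normal[OF J]],
        rule coprime_of_no_common_prime)
      fix q assume q: "Factorial_Ring.prime q" "q dvd card (N k)" "q dvd order A div card ?J"
      have qD: "q dvd D k" by (rule prime_dvd_card_N[OF q(1,2)])
      hence "q dvd card (UNIV :: 'a set)" using D_dvd_degree by (rule dvd_trans)
      then obtain m where m: "m < n" "q = p (\<tau> m)"
        using prime_dvd_degree_iff[OF q(1)] \<tau>_surj by blast
      hence "level (p (\<tau> m)) \<le> k" using qD level_p(1)[OF \<tau>_less[OF m(1)]] by simp
      hence "m < i" using mono[of i m] m k by (cases "m < i") auto
      hence "P (\<tau> m) \<subseteq> ?J" using iterated_prod_mono[of i "P \<circ> \<tau>" m] ideals i by simp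
      thus False using not_dvd_index[OF \<tau>_less[OF m(1)] J] q(3) m by blast
    qed
    moreover have "iterated_prod (P \<circ> \<tau>) (Suc i) \<subseteq> N (Suc k)"
    proof (rule iterated_prod_least[OF left_ideal_socle_series])
      fix l assume "l < Suc i"
      hence "level (p (\<tau> l)) \<le> Suc k" using mono[of l i] i k by simp
      thus "(P \<circ> \<tau>) l \<subseteq> N (Suc k)" using P_subset_N[OF \<tau>_less] \<open>l < Suc i\<close> i by (simp del: socle_series.simps)
    qed
    ultimately show ?thesis by blast
  qed
  moreover have "P (\<tau> 0) \<subseteq> N 1"
  proof (rule P_subset_N[OF \<tau>_less[OF assms]])
    have "card (UNIV :: 'a set) \<noteq> 1" using p_dvd_degree[OF assms] p_prime[OF assms] not_prime_unit by auto
    hence "card (UNIV :: 'a set) > 1" using D_pos[of height] D_height by simp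
    then obtain q where q: "Factorial_Ring.prime q" "q dvd D 1" by (rule ex_level_one)
    hence "q dvd card (UNIV :: 'a set)" using D_dvd_degree dvd_trans by blast
    then obtain m where m: "m < n" "q = p (\<tau> m)"
      using prime_dvd_degree_iff[OF q(1)] \<tau>_surj by blast
    hence "level (p (\<tau> m)) \<le> 1" using level_p(1)[OF \<tau>_less[OF m(1)]] q by simp
    thus "level (p (\<tau> 0)) \<le> 1" using mono[of 0 m] m by simp
  qed
  ultimately show thesis using \<tau> that by blast
qed

text \<open>Partial products need not be terms of the series, so their Hall property is obtained
  from the Sylow factors. It feeds the coprimality hypothesis of
  \<open>mem_of_preserves_orbits\<close>.\<close>

lemma coprime_card_index_iterated_prod:
  assumes "\<And>l. l < k \<Longrightarrow> \<tau> l < n"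
  shows "coprime (card (iterated_prod (P \<circ> \<tau>) k)) (order A div card (iterated_prod (P \<circ> \<tau>) k))"
proof (rule coprime_of_no_common_prime)
  have ideals: "left_ideal ((P \<circ> \<tau>) l)" if "l < k" for l
    using that assms P_left_ideal by simp
  let ?J = "iterated_prod (P \<circ> \<tau>) k"
  have J: "subgroup ?J A"
    using left_ideal_iterated_prod[of k "P \<circ> \<tau>"] ideals by (simp add: left_ideal_def)
  fix q assume q: "Factorial_Ring.prime q" "q dvd card ?J" "q dvd order A div card ?J"
  obtain l where l: "l < k" "q dvd card (P (\<tau> l))"
    using prime_dvd_card_iterated_prod[OF finite_B q(1) ideals q(2)] by auto
  hence "q = p (\<tau> l)" using prime_dvd_card_P assms q(1) by blast
  moreover have "P (\<tau> l) \<subseteq> ?J" using iterated_prod_mono[of k "P \<circ> \<tau>" l] ideals l by simp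
  ultimately show False using not_dvd_index[OF assms[OF l(1)] J] q(3) by blast
qed

end

text \<open>If \<open>g x = h x\<close> with \<open>h \<in> L\<close>, then \<open>g\<close> and \<open>h\<close> commute modulo \<open>N k\<close>, so
  \<open>g [^] card L\<close> moves \<open>x\<close> within its orbit under \<open>N k\<close>.\<close>

lemma mem_of_preserves_orbits:
  assumes L: "L \<lhd> M" "N k \<subseteq> L" "L \<subseteq> N (Suc k)"
    and cop: "coprime (card L) (order A div card L)"
    and g: "g \<in> B" "\<And>x. g x \<in> perm.orb L x"
  shows "g \<in> L"
proof -
  interpret L: normal L M by fact
  interpret K: normal "N k" M by (rule N_normal)
  have KB: "u \<in> carrier M" if "u \<in> N (Suc k)" for u using N_closed[OF that] carrier_eq by simp
  have gM: "g \<in> carrier M" using g carrier_eq by simp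
  \<comment> \<open>Saturation does apply to N_(k+1), whose orbits contain those of L.\<close>
  have "g \<in> N (Suc k)"
    by (rule saturated[OF gM]) (use g(2) L(3) in \<open>auto simp: perm.orb_def simp del: socle_series.simps\<close>)
  interpret S: subgroup "N (Suc k)" M by (rule N_subgroup)
  have swap: "\<exists>c\<in>N k. a \<star> b = c \<star> (b \<star> a)" if "a \<in> N (Suc k)" "b \<in> N (Suc k)" for a b
  proof -
    have ab: "a \<in> carrier M" "b \<in> carrier M" using that KB by blast+
    have "rec (b \<star> a) \<star> (a \<star> b) \<in> N k"
      using socle_over_commutator[OF braceideal_socle_series] that by simp
    hence "(b \<star> a) \<star> (rec (b \<star> a) \<star> (a \<star> b)) \<star> rec (b \<star> a) \<in> N k"
      using ab by (intro K.inv_op_closed2) auto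
    hence "(a \<star> b) \<star> rec (b \<star> a) \<in> N k" using ab carrier_eq by simp
    moreover have "a \<star> b = (a \<star> b) \<star> rec (b \<star> a) \<star> (b \<star> a)" using ab by (simp add: mul.m_assoc)
    ultimately show ?thesis by blast
  qed
  have gpow: "g [^]\<^bsub>M\<^esub> m \<in> N (Suc k)" for m :: nat
    using \<open>g \<in> N (Suc k)\<close> by (induction m) (simp_all del: socle_series.simps)
  have "(g [^]\<^bsub>M\<^esub> card L) x \<in> perm.orb (N k) x" for x
  proof -
    obtain h where h: "h \<in> L" "g x = h x" using g(2)[of x] by (auto simp: perm.orb_def)
    have hM: "h \<in> carrier M" "h \<in> N (Suc k)" using h L KB by blast+
    have "\<exists>u\<in>N k. (g [^]\<^bsub>M\<^esub> m) x = u ((h [^]\<^bsub>M\<^esub> m) x)" for m :: nat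
    proof (induction m)
      case 0
      show ?case using K.one_closed by (intro bexI[of _ "\<one>\<^bsub>M\<^esub>"]) (simp_all add: one_id)
    next
      \<comment> \<open>g^(m+1) x = g^m h x = c h g^m x = c h u h^m x, and normality of N_k turns c
        h u into an element of N_k times h.\<close>
      case (Suc m)
      then obtain u where u: "u \<in> N k" "(g [^]\<^bsub>M\<^esub> m) x = u ((h [^]\<^bsub>M\<^esub> m) x)" by blast
      obtain c where c: "c \<in> N k" "g [^]\<^bsub>M\<^esub> m \<star> h = c \<star> (h \<star> g [^]\<^bsub>M\<^esub> m)"
        using swap[OF gpow hM(2)] by blast
      have "(g [^]\<^bsub>M\<^esub> Suc m) x = (g [^]\<^bsub>M\<^esub> m \<star> h) x"
        using h by (simp add: perm.mult_apply)
      also have "\<dots> = (c \<star> (h \<star> u \<star> rec h)) (h ((h [^]\<^bsub>M\<^esub> m) x))"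
        using c u hM by (simp add: perm.mult_apply)
      also have "h ((h [^]\<^bsub>M\<^esub> m) x) = (h [^]\<^bsub>M\<^esub> Suc m) x"
        unfolding mul.nat_pow_Suc2[OF hM(1)] by (simp add: perm.mult_apply)
      finally show ?case
        using K.m_closed[OF c(1) K.inv_op_closed2[OF hM(1) u(1)]] by blast
    qed
    \<comment> \<open>h depends on x, but its power by \<open>card L\<close> is always the identity,
      so one exponent serves every x.\<close>
    from this[of "card L"] show ?thesis
      using mul.pow_card_subgroup[OF L.subgroup_axioms h(1)] by (auto simp: perm.orb_def one_id)
  qed
  hence "g [^]\<^bsub>M\<^esub> card L \<in> N k" using gM by (intro saturated) auto
  hence "g [^]\<^bsub>M\<^esub> card L \<in> L" using L by blast
  thus ?thesis
    using mul.coprime_pow_mem[OF L.subgroup_axioms gM _ _ cop] mul.pow_index_mem[OF L(1) finite_carrier_M gM]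
    by (simp add: order_M)
qed

end

section \<open>The permutation brace of a solution\<close>

locale solution =
  fixes sig gam :: "'a::finite \<Rightarrow> 'a \<Rightarrow> 'a"
  assumes is_solution: "is_solution sig gam"
begin

abbreviation finv where "finv \<equiv> inv_into UNIV"

section \<open>The cycle identity and the diagonal map\<close>

lemma bij_sig: "bij (sig x)" and bij_gam: "bij (gam x)"
  using is_solution by (auto simp: is_solution_def)

lemma sig_inv [simp]: "sig x (finv (sig x) y) = y" "finv (sig x) (sig x y) = y"
  using bij_sig[of x] by (simp_all add: bij_is_surj surj_f_inv_f bij_is_inj)

lemma sig_gam: "sig (sig x y) (gam y x) = x"
proof -
  have "(sol_r sig gam \<circ> sol_r sig gam) (x, y) = (x, y)"
    using is_solution by (simp add: is_solution_def)
  thus ?thesis by (simp add: sol_r_def)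
qed

lemma sig_comp: "sig x \<circ> sig y = sig (sig x y) \<circ> sig (gam y x)"
proof
  fix z
  let ?r = "sol_r sig gam"
  have "(r12 ?r \<circ> r23 ?r \<circ> r12 ?r) (x, y, z) = (r23 ?r \<circ> r12 ?r \<circ> r23 ?r) (x, y, z)"
    using is_solution by (simp add: is_solution_def)
  thus "(sig x \<circ> sig y) z = (sig (sig x y) \<circ> sig (gam y x)) z"
    by (simp add: sol_r_def r12_def r23_def)
qed

text \<open>\<open>sig_comp\<close> with \<open>finv (sig x) y\<close> in place of y, where
  involutivity evaluates \<open>gam\<close>. This is the law of a cycle set; it expresses that the
  basis vectors of x and y commute in the additive group.\<close>

lemma cycle_identity: "sig x \<circ> sig (finv (sig x) y) = sig y \<circ> sig (finv (sig y) x)"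
proof -
  have "gam (finv (sig x) y) x = finv (sig y) x"
    using sig_gam[of x "finv (sig x) y"] by (metis sig_inv)
  thus ?thesis using sig_comp[of x "finv (sig x) y"] by simp
qed

text \<open>With y = \<open>finv (sig x) x\<close> involutivity gives \<open>gam y x = y\<close>, so
  y determines x because \<open>gam y\<close> is bijective.\<close>

lemma inj_diagonal: "inj (\<lambda>x. finv (sig x) x)"
proof (rule injI)
  have gam: "gam (finv (sig x) x) x = finv (sig x) x" for x
    using sig_gam[of x "finv (sig x) x"] by (metis sig_inv)
  fix x y assume "finv (sig x) x = finv (sig y) y"
  thus "x = y" using gam[of x] gam[of y] bij_gam[of "finv (sig x) x"] by (metis bij_pointE)
qed

text \<open>
  Right multiplication by \<open>(e_x, sig x)\<close> in \<open>Z^X \<rtimes> Sym_X\<close> adds \<open>e_z\<close>, where \<open>z = g x\<close>,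
  to the first coordinate of \<open>(a, g)\<close>. Indexed by \<open>z\<close>, its effect on the second coordinate
  depends on \<open>g\<close> only, and the cycle identity says that these operators commute.
\<close>

definition step :: "'a \<Rightarrow> ('a \<Rightarrow> 'a) \<Rightarrow> 'a \<Rightarrow> 'a" where
  "step z g = (if bij g then g \<circ> sig (finv g z) else g)"

lemma bij_step [simp]: "bij (step z g) \<longleftrightarrow> bij g"
  by (simp add: step_def bij_comp bij_sig)

text \<open>For u = g^-1 z and v = g^-1 w both sides are g composed with a side of the cycle
  identity at u, v. Fixing the maps that are not bijective makes the law hold on the whole type, as
  \<open>comp_fun_commute\<close> demands.\<close>

lemma step_commute: "step w (step z g) = step z (step w g)"
proof (cases "bij g")
  case True
  have "step w (step z g) = g \<circ> (sig (finv g z) \<circ> sig (finv (sig (finv g z)) (finv g w)))" for w z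
    using True bij_sig by (simp add: step_def bij_comp o_inv_distrib o_assoc)
  thus ?thesis using cycle_identity by simp
qed (simp add: step_def)

sublocale comp_fun_commute step
  by unfold_locales (simp add: fun_eq_iff step_commute)

text \<open>The inverse of \<open>step z g\<close> sends z to the image of u = g^-1 z under the
  diagonal map. Injectivity of that map recovers u, and cancelling \<open>sig u\<close> recovers
  g.\<close>

lemma inj_step: "inj (step z)"
proof (rule injI)
  fix g h assume eq: "step z g = step z h"
  hence bij: "bij g \<longleftrightarrow> bij h" by (metis bij_step)
  show "g = h"
  proof (cases "bij g")
    case True
    have inv_step: "finv (step z g) z = finv (sig (finv g z)) (finv g z)" if "bij g" for g
      using that bij_sig by (simp add: step_def o_inv_distrib)
    have "finv g z = finv h z"
      using inv_step[of g] inv_step[of h] True bij eq injD[OF inj_diagonal] by metis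
    hence "g \<circ> sig (finv g z) = h \<circ> sig (finv g z)" using eq True bij by (simp add: step_def)
    thus ?thesis using bij_sig[of "finv g z"] by (metis bij_is_surj comp_assoc comp_id surj_iff)
  qed (use eq bij in \<open>simp add: step_def\<close>)
qed

text \<open>A multiset is a nonnegative vector in the free abelian group on X, and
  \<open>act M id\<close> is its image under the epimorphism onto the permutation group.\<close>

definition act :: "'a multiset \<Rightarrow> ('a \<Rightarrow> 'a) \<Rightarrow> 'a \<Rightarrow> 'a" where
  "act M g = fold_mset step g M"

lemma act_empty [simp]: "act {#} g = g"
  by (simp add: act_def)

lemma act_add_mset: "act (add_mset z M) g = step z (act M g)" "act (add_mset z M) g = act M (step z g)"
  by (simp_all add: act_def fold_mset_fun_left_comm)

lemma act_union: "act (M + N) g = act M (act N g)"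
  unfolding act_def by (metis add.commute fold_mset_union)

lemma bij_act [simp]: "bij (act M g) \<longleftrightarrow> bij g"
  by (induction M) (simp_all add: act_add_mset(1))

lemma inj_act: "inj (act M)"
proof (induction M)
  case (add z M)
  have eq: "act (add_mset z M) = step z \<circ> act M" by (simp add: fun_eq_iff act_add_mset(1))
  show ?case unfolding eq by (rule inj_compose[OF inj_step add])
qed (simp add: inj_on_def)

text \<open>Left composition with g carries \<open>step z\<close> to \<open>step (g z)\<close>. Both
  the formula for \<open>lam\<close> on generators and brace distributivity come from this.\<close>

lemma comp_act: "bij g \<Longrightarrow> bij h \<Longrightarrow> g \<circ> act M h = act (image_mset g M) (g \<circ> h)"
proof (induction M)
  case (add z M)
  have "g \<circ> step z k = step (g z) (g \<circ> k)" if "bij k" for k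
    using that add.prems by (simp add: step_def bij_comp o_inv_distrib bij_is_inj o_assoc)
  thus ?case using add by (simp add: act_add_mset(1) del: comp_apply)
qed simp

lemma permgrp_bij: "g \<in> permgrp sig \<Longrightarrow> bij g"
  by (induction rule: permgrp.induct) (blast intro: bij_id bij_comp bij_sig bij_imp_bij_inv)+

lemma step_permgrp: "g \<in> permgrp sig \<Longrightarrow> step z g \<in> permgrp sig"
  by (simp add: step_def pg_gen)

lemma act_permgrp: "g \<in> permgrp sig \<Longrightarrow> act M g \<in> permgrp sig"
  by (induction M) (simp_all add: act_add_mset(1) step_permgrp)

lemma step_comp_inv: "bij g \<Longrightarrow> step (g (finv (sig x) x)) (g \<circ> finv (sig x)) = g"
  using bij_sig[of x]
  by (simp add: step_def bij_comp bij_imp_bij_inv o_inv_distrib inv_inv_eq bij_is_inj fun_eq_iff)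

lemma act_power: "act (repeat_mset m M) g = (act M ^^ m) g"
  by (induction m) (simp_all add: act_union)

text \<open>By finiteness the injective map \<open>act M\<close> is periodic at g, with some period
  m > 0; m - 1 further copies of M undo the first. Negative vectors are thereby avoided.\<close>

lemma act_inverse: obtains N where "act N (act M g) = g"
proof -
  obtain m where m: "0 < m" "(act M ^^ m) g = g"
    using funpow_inj_finite[OF inj_act, of M g] by auto
  obtain m' where "m = Suc m'" using m by (cases m) auto
  hence "act (repeat_mset m' M) (act M g) = g"
    using m by (simp add: act_power funpow_swap1)
  thus thesis by (rule that)
qed

lemma permgrp_act: "g \<in> permgrp sig \<Longrightarrow> \<exists>M. g = act M id"
proof (induction rule: permgrp.induct)
  case pg_id
  show ?case by (metis act_empty)
next
  case (pg_gen g x)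
  then obtain M where M: "g = act M id" by blast
  have "g \<circ> sig x = step (g x) g"
    using permgrp_bij[OF pg_gen.hyps] by (simp add: step_def bij_is_inj)
  thus ?case using M by (metis act_add_mset(1))
next
  case (pg_inv g x)
  then obtain M where M: "g = act M id" by blast
  let ?h = "g \<circ> finv (sig x)" and ?z = "g (finv (sig x) x)"
  obtain N where "act N (act {#?z#} ?h) = ?h" by (rule act_inverse)
  moreover have "act {#?z#} ?h = g"
    using step_comp_inv[OF permgrp_bij[OF pg_inv.hyps]] by (simp add: act_add_mset)
  ultimately have "?h = act (N + M) id" using M by (simp add: act_union)
  thus ?case by blast
qed

lemma Gam_act: "((\<lambda>z. int (count M z)), act M id) \<in> Gam sig"
proof (induction M)
  case empty
  show ?case unfolding act_empty count_empty of_nat_0 by (rule Gam_one)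
next
  case (add z M)
  let ?g = "act M id"
  have "bij ?g" by simp
  hence "?g (finv ?g z) = z" by (simp add: bij_is_surj surj_f_inv_f)
  moreover from this have "step z ?g = ?g \<circ> sig (finv ?g z)" using \<open>bij ?g\<close> by (simp add: step_def)
  moreover have "(\<lambda>y. int (count M y) + (if y = z then 1 else 0)) = (\<lambda>y. int (count (add_mset z M) y))"
    by auto
  ultimately show ?case using Gam_gen[OF add, of "finv ?g z"] by (simp add: act_add_mset(1) del: comp_apply id_apply count_add_mset)
qed

text \<open>First coordinates in the structure group may be negative, so a is written as M - N, and
  the relation for g is stated with N moved to the left. Injectivity of \<open>act N\<close> then
  makes g depend on a alone.\<close>

lemma Gam_difference:
  "(a, g) \<in> Gam sig \<Longrightarrow> bij g \<and> (\<exists>M N. (\<forall>z. a z + int (count N z) = int (count M z)) \<and> act N g = act M id)"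
proof (induction rule: Gam.induct)
  case Gam_one
  show ?case by (intro conjI exI[of _ "{#}"]) (simp_all del: id_apply)
next
  case (Gam_gen a g x)
  then obtain M N where MN: "bij g" "\<forall>z. a z + int (count N z) = int (count M z)" "act N g = act M id" by blast
  have "g \<circ> sig x = step (g x) g" using MN by (simp add: step_def bij_is_inj)
  hence "act N (g \<circ> sig x) = act (add_mset (g x) M) id"
    using MN(3) by (metis act_add_mset)
  moreover have "\<forall>z. (a z + (if z = g x then 1 else 0)) + int (count N z) = int (count (add_mset (g x) M) z)"
    using MN(2) by (auto simp: algebra_simps)
  ultimately show ?case using MN(1) bij_sig bij_comp by blast
next
  case (Gam_inv a g x)
  then obtain M N where MN: "bij g" "\<forall>z. a z + int (count N z) = int (count M z)" "act N g = act M id" by blast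
  let ?z = "g (finv (sig x) x)"
  have "act (add_mset ?z N) (g \<circ> finv (sig x)) = act M id"
    using MN(3) step_comp_inv[OF MN(1)] by (simp add: act_add_mset(2))
  moreover have "\<forall>z. (a z - (if z = ?z then 1 else 0)) + int (count (add_mset ?z N) z) = int (count M z)"
    using MN(2) by (auto simp: algebra_simps)
  moreover have "bij (g \<circ> finv (sig x))" using MN(1) bij_sig bij_comp bij_imp_bij_inv by blast
  ultimately show ?case by blast
qed

text \<open>Uniqueness in the definite description: presenting a, b and a + b as differences and
  eliminating a and b gives one multiset equation, and the injective operator
  \<open>act (N1 + N2 + N3)\<close> can be cancelled.\<close>

lemma gadd_act: "gadd sig (act M id) (act N id) = act (M + N) id"
  unfolding gadd_def
proof (rule the_equality)
  have "(\<lambda>z. int (count M z) + int (count N z)) = (\<lambda>z. int (count (M + N) z))" by auto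
  thus "\<exists>a b. (a, act M id) \<in> Gam sig \<and> (b, act N id) \<in> Gam sig \<and> ((\<lambda>z. a z + b z), act (M + N) id) \<in> Gam sig"
    using Gam_act by metis
next
  fix k assume "\<exists>a b. (a, act M id) \<in> Gam sig \<and> (b, act N id) \<in> Gam sig \<and> ((\<lambda>z. a z + b z), k) \<in> Gam sig"
  then obtain a b where ab: "(a, act M id) \<in> Gam sig" "(b, act N id) \<in> Gam sig" "((\<lambda>z. a z + b z), k) \<in> Gam sig"
    by blast
  obtain M1 N1 where 1: "\<And>z. a z + int (count N1 z) = int (count M1 z)" "act N1 (act M id) = act M1 id"
    using Gam_difference[OF ab(1)] by blast
  obtain M2 N2 where 2: "\<And>z. b z + int (count N2 z) = int (count M2 z)" "act N2 (act N id) = act M2 id"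
    using Gam_difference[OF ab(2)] by blast
  obtain M3 N3 where 3: "\<And>z. a z + b z + int (count N3 z) = int (count M3 z)" "act N3 k = act M3 id"
    using Gam_difference[OF ab(3)] by blast
  have eq: "M3 + N1 + N2 = M1 + M2 + N3"
  proof (rule multiset_eqI)
    fix z
    have "int (count (M3 + N1 + N2) z) = int (count (M1 + M2 + N3) z)"
      using 1(1)[of z] 2(1)[of z] 3(1)[of z] by simp
    thus "count (M3 + N1 + N2) z = count (M1 + M2 + N3) z" by linarith
  qed
  have "act (N1 + N2 + N3) k = act (M3 + N1 + N2) id"
    using 3(2) by (metis act_union add.commute)
  also have "\<dots> = act (N3 + M1 + M2) id" unfolding eq by (simp add: ac_simps)
  also have "\<dots> = act (N3 + M1 + N2 + N) id" using 2(2) by (simp add: act_union)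
  also have "\<dots> = act (N3 + N2 + N) (act M1 id)" by (simp add: ac_simps flip: act_union)
  also have "\<dots> = act (N1 + N2 + N3) (act (M + N) id)"
    unfolding 1(2)[symmetric] by (simp add: ac_simps flip: act_union)
  finally show "k = act (M + N) id" using injD[OF inj_act] by blast
qed

lemma gadd_act_left: "g \<in> permgrp sig \<Longrightarrow> gadd sig g (act N id) = act N g"
  using permgrp_act[of g] gadd_act by (metis act_union add.commute)

lemma permgrp_comp: "h \<in> permgrp sig \<Longrightarrow> g \<in> permgrp sig \<Longrightarrow> g \<circ> h \<in> permgrp sig"
  by (induction rule: permgrp.induct) (simp_all add: o_assoc permgrp.intros)

lemma permgrp_inv: "g \<in> permgrp sig \<Longrightarrow> finv g \<in> permgrp sig"
proof (induction rule: permgrp.induct)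
  case pg_id
  show ?case using permgrp.pg_id by (simp add: inv_id del: id_apply)
next
  case (pg_gen g x)
  have "id \<circ> finv (sig x) \<in> permgrp sig" by (intro permgrp.intros)
  hence "finv (sig x) \<in> permgrp sig" by simp
  thus ?case using pg_gen permgrp_bij[OF pg_gen.hyps] bij_sig by (simp add: o_inv_distrib permgrp_comp del: comp_apply)
next
  case (pg_inv g x)
  have "id \<circ> sig x \<in> permgrp sig" by (intro permgrp.intros)
  hence "sig x \<in> permgrp sig" by simp
  thus ?case using pg_inv permgrp_bij[OF pg_inv.hyps] bij_sig[of x]
    by (simp add: o_inv_distrib permgrp_comp bij_imp_bij_inv inv_inv_eq del: comp_apply)
qed

lemma sig_permgrp: "sig x \<in> permgrp sig"
  using permgrp.pg_gen[OF permgrp.pg_id, of sig x] by simp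

section \<open>The left brace of a solution\<close>

lemma comm_group_addG: "comm_group (addG sig)"
proof (rule comm_groupI; unfold addG_def; simp)
  fix g assume g: "g \<in> permgrp sig"
  obtain M where M: "g = act M id" using permgrp_act[OF g] by blast
  show "gadd sig id g = g" using gadd_act[of "{#}" M] M by simp
  obtain N where "act N (act M id) = id" by (rule act_inverse)
  hence "gadd sig (act N id) g = id" using M gadd_act by (simp add: act_union)
  thus "\<exists>h\<in>permgrp sig. gadd sig h g = id" using act_permgrp pg_id by blast
  fix h assume h: "h \<in> permgrp sig"
  obtain N where N: "h = act N id" using permgrp_act[OF h] by blast
  show "gadd sig g h \<in> permgrp sig" unfolding M N by (simp add: gadd_act act_permgrp pg_id)
  show "gadd sig g h = gadd sig h g" unfolding M N by (simp add: gadd_act add.commute)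
  fix k assume k: "k \<in> permgrp sig"
  obtain K where K: "k = act K id" using permgrp_act[OF k] by blast
  show "gadd sig (gadd sig g h) k = gadd sig g (gadd sig h k)"
    unfolding M N K by (simp add: gadd_act add.assoc)
qed (rule pg_id)

lemma group_mulG: "group (mulG sig)"
proof (rule groupI; unfold mulG_def; simp add: permgrp_comp pg_id o_assoc)
  fix g assume "g \<in> permgrp sig"
  thus "\<exists>h\<in>permgrp sig. h \<circ> g = id"
    using permgrp_inv permgrp_bij by (metis bij_is_inj inv_o_cancel)
qed

text \<open>If g is the image of L, composing g with the image of K gives the image of g(K) + L.
  Both sides of the distributive law are then the image of g(M) + g(N) + 2L.\<close>

sublocale left_brace "addG sig" "mulG sig"
proof (intro left_brace.intro comm_group_addG group_mulG left_brace_axioms.intro)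
  show "carrier (mulG sig) = carrier (addG sig)" by (simp add: addG_def mulG_def)
  fix g h k assume "g \<in> carrier (addG sig)" "h \<in> carrier (addG sig)" "k \<in> carrier (addG sig)"
  hence ghk: "g \<in> permgrp sig" "h \<in> permgrp sig" "k \<in> permgrp sig" by (simp_all add: addG_def)
  obtain L M N where LMN: "g = act L id" "h = act M id" "k = act N id"
    using permgrp_act ghk by metis
  have comp: "g \<circ> act K id = act (image_mset g K + L) id" for K
    using comp_act[OF permgrp_bij[OF ghk(1)], of id K] LMN by (simp add: act_union)
  have "gadd sig (g \<circ> act (M + N) id) (act L id) = gadd sig (g \<circ> act M id) (g \<circ> act N id)"
    unfolding comp gadd_act by (simp add: ac_simps)
  thus "g \<otimes>\<^bsub>mulG sig\<^esub> (h \<otimes>\<^bsub>addG sig\<^esub> k) \<otimes>\<^bsub>addG sig\<^esub> g =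
      g \<otimes>\<^bsub>mulG sig\<^esub> h \<otimes>\<^bsub>addG sig\<^esub> (g \<otimes>\<^bsub>mulG sig\<^esub> k)"
    by (simp add: addG_def mulG_def LMN(2,3) gadd_act flip: LMN(1))
qed

end

section \<open>Socle series and iterated retracts\<close>

context solution
begin

notation badd (infixl "\<boxplus>" 65)
notation bmul (infixl "\<star>" 70)

lemma brace_simps:
  "carrier (addG sig) = permgrp sig" "carrier (mulG sig) = permgrp sig"
  "g \<otimes>\<^bsub>addG sig\<^esub> h = gadd sig g h" "g \<otimes>\<^bsub>mulG sig\<^esub> h = g \<circ> h"
  "\<one>\<^bsub>addG sig\<^esub> = id" "\<one>\<^bsub>mulG sig\<^esub> = id"
  by (simp_all add: addG_def mulG_def)

lemma blam_eq: "blam sig = lam"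
  by (intro ext) (simp add: blam_def lam_def brace_simps)

lemma brace_ideal_eq: "brace_ideal sig I \<longleftrightarrow> braceideal I"
  by (simp add: brace_ideal_def braceideal_def blam_eq brace_simps)

lemma mprod_eq: "mprod sig Q k = iterated_prod Q k"
  by (induction k) (simp_all add: brace_simps)

sublocale perm: perm_group "mulG sig"
  by unfold_locales (simp_all add: brace_simps)

lemma inv_mulG: "g \<in> permgrp sig \<Longrightarrow> rec g = finv g"
  using mul.inv_equality[of "finv g" g] permgrp_inv permgrp_bij
  by (simp add: brace_simps bij_is_inj)

lemma lam_sig:
  assumes g: "g \<in> permgrp sig" shows "lam g (sig x) = sig (g x)"
proof -
  have sig: "sig x = act {#x#} id" for x by (simp add: act_add_mset step_def)
  have "g \<circ> sig x = act {#g x#} g"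
    using comp_act[OF permgrp_bij[OF g] bij_id, of "{#x#}"] sig[of x] by simp
  also have "\<dots> = gadd sig g (sig (g x))"
    using gadd_act_left[OF g, of "{#g x#}"] sig[of "g x"] by simp
  finally have "g \<star> sig x = g \<boxplus> sig (g x)" by (simp add: brace_simps)
  thus ?thesis unfolding lam_def using g sig_permgrp by (simp add: brace_simps(1))
qed

lemma additive_induct [consumes 1, case_names zero add]:
  assumes "b \<in> permgrp sig" "Q id"
    and add: "\<And>b x. b \<in> permgrp sig \<Longrightarrow> Q b \<Longrightarrow> Q (b \<boxplus> sig x)"
  shows "Q b"
proof -
  have "Q (act M id)" for M
  proof (induction M)
    case (add z M)
    have "act (add_mset z M) id = gadd sig (act M id) (act {#z#} id)"
      unfolding gadd_act by simp
    also have "act {#z#} id = sig z" by (simp add: act_add_mset step_def)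
    finally show ?case using assms(3)[OF act_permgrp[OF pg_id] add] by (simp add: brace_simps)
  qed (simp add: assms(2) del: id_apply)
  thus ?thesis using permgrp_act[OF assms(1)] by blast
qed

text \<open>\<open>lam g\<close> is additive, so its triviality modulo I can be tested on the
  generators \<open>sig x\<close>, which it permutes according to the action of g on X.\<close>

lemma socle_over_iff_sig:
  assumes I: "left_ideal I" and g: "g \<in> permgrp sig"
  shows "g \<in> socle_over I \<longleftrightarrow> (\<forall>x. neg (sig x) \<boxplus> sig (g x) \<in> I)"
proof
  assume "g \<in> socle_over I"
  thus "\<forall>x. neg (sig x) \<boxplus> sig (g x) \<in> I"
    using lam_sig[OF g] sig_permgrp by (metis (no_types, lifting) brace_simps(1) mem_Collect_eq socle_over_def)
next
  interpret I: subgroup I "addG sig" using I by (simp add: left_ideal_def)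
  assume *: "\<forall>x. neg (sig x) \<boxplus> sig (g x) \<in> I"
  have gB: "g \<in> B" and sigB: "\<And>x. sig x \<in> B" using g sig_permgrp by (simp_all add: brace_simps)
  have "neg b \<boxplus> lam g b \<in> I" if "b \<in> permgrp sig" for b
    using that
  proof (induction rule: additive_induct)
    case zero
    show ?case using gB by (simp flip: brace_simps(5))
  next
    case (add b x)
    have b: "b \<in> B" using add by (simp add: brace_simps)
    have "neg (b \<boxplus> sig x) \<boxplus> lam g (b \<boxplus> sig x) = (neg b \<boxplus> lam g b) \<boxplus> (neg (sig x) \<boxplus> sig (g x))"
      using b gB sigB by (simp add: lam_add lam_sig[OF g] add.inv_mult add.m_ac)
    thus ?case using add.IH * by simp
  qed
  thus "g \<in> socle_over I" using g by (simp add: socle_over_def brace_simps(1))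
qed

text \<open>The core is \<open>ret\<close> in the induction step: points agree in the retract of
  order k + 1 iff their \<open>sig\<close> are congruent modulo N_k. Invariance at k moves
  \<open>sig y\<close> across the relation, the kernel claim at k turns the pointwise relation into
  membership in N_k, and \<open>left_ideal_congruent\<close> passes to addition.\<close>

lemma ret_rel_socle_series:
  "equivp (ret_rel sig k)"
  "\<And>g x y. g \<in> permgrp sig \<Longrightarrow> ret_rel sig k x y \<Longrightarrow> ret_rel sig k (g x) (g y)"
  "\<And>g. g \<in> permgrp sig \<Longrightarrow> g \<in> socle_series k \<longleftrightarrow> (\<forall>x. ret_rel sig k (g x) x)"
proof (induction k)
  case 0
  show "equivp (ret_rel sig 0)" by (auto intro!: equivpI reflpI sympI transpI)
  show "ret_rel sig 0 (g x) (g y)" if "ret_rel sig 0 x y" for g x y using that by simp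
  show "g \<in> socle_series 0 \<longleftrightarrow> (\<forall>x. ret_rel sig 0 (g x) x)" for g
    by (auto simp: brace_simps)
next
  case (Suc k)
  let ?I = "socle_series k"
  have ideal: "left_ideal ?I" by (rule left_ideal_socle_series)
  interpret I: subgroup ?I "addG sig" using ideal by (simp add: left_ideal_def)
  have sigB: "\<And>x. sig x \<in> B" using sig_permgrp by (simp add: brace_simps)
  have ret: "ret_rel sig (Suc k) x y \<longleftrightarrow> neg (sig y) \<boxplus> sig x \<in> ?I" for x y
  proof -
    have finv: "finv (sig y) \<in> permgrp sig" by (intro permgrp_inv sig_permgrp)
    have "ret_rel sig (Suc k) x y \<longleftrightarrow> (\<forall>z. ret_rel sig k (finv (sig y) (sig x z)) z)"
      using Suc.IH(2)[OF finv] Suc.IH(2)[OF sig_permgrp[of y]]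
      by (metis ret_rel.simps(2) sig_inv)
    also have "\<dots> \<longleftrightarrow> finv (sig y) \<circ> sig x \<in> ?I"
      unfolding Suc.IH(3)[OF permgrp_comp[OF sig_permgrp finv]] comp_apply ..
    also have "finv (sig y) \<circ> sig x = rec (sig y) \<star> sig x"
      using inv_mulG[OF sig_permgrp] by (simp add: brace_simps)
    also have "\<dots> \<in> ?I \<longleftrightarrow> neg (sig y) \<boxplus> sig x \<in> ?I"
      by (rule left_ideal_congruent[OF ideal sigB sigB])
    finally show ?thesis .
  qed
  show "equivp (ret_rel sig (Suc k))"
  proof (intro equivpI reflpI sympI transpI; unfold ret)
    show "neg (sig x) \<boxplus> sig x \<in> ?I" for x using sigB by simp
    show "neg (sig x) \<boxplus> sig y \<in> ?I" if "neg (sig y) \<boxplus> sig x \<in> ?I" for x y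
      using I.m_inv_closed[OF that] sigB by (simp add: add.inv_mult_group)
    show "neg (sig z) \<boxplus> sig x \<in> ?I" if "neg (sig y) \<boxplus> sig x \<in> ?I" "neg (sig z) \<boxplus> sig y \<in> ?I" for x y z
      using I.m_closed[OF that(2,1)] sigB by (simp flip: add_telescope)
  qed
  show "ret_rel sig (Suc k) (g x) (g y)" if g: "g \<in> permgrp sig" and "ret_rel sig (Suc k) x y" for g x y
  proof -
    have "lam g (neg (sig y) \<boxplus> sig x) \<in> ?I"
      using that ideal unfolding ret left_ideal_def by (simp add: brace_simps(1))
    moreover have "g \<in> B" using g by (simp add: brace_simps)
    ultimately show ?thesis unfolding ret using sigB by (simp add: lam_add lam_neg lam_sig[OF g])
  qed
  show "g \<in> socle_series (Suc k) \<longleftrightarrow> (\<forall>x. ret_rel sig (Suc k) (g x) x)" if "g \<in> permgrp sig" for g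
    unfolding ret using socle_over_iff_sig[OF ideal that] by simp
qed

text \<open>Elements of N_k act trivially on the retract of order k, so each N_k-orbit lies in one
  class; this gives saturation. When that retract is a point, the kernel is the whole group.\<close>

lemma transitive_brace:
  assumes "indecomposable sig" "multipermutation sig" "squarefree (card (UNIV :: 'a set))"
  shows "transitive_brace (addG sig) (mulG sig)"
proof
  show "\<exists>g\<in>carrier (mulG sig). g x = y" for x y
    using assms(1) by (simp add: indecomposable_def brace_simps(2))
  show "g \<in> socle_series k"
    if "g \<in> carrier (mulG sig)" and orb: "\<And>x. g x \<in> perm.orb (socle_series k) x" for g k
  proof -
    have g: "g \<in> permgrp sig" using that by (simp add: brace_simps)
    interpret N: subgroup "socle_series k" "addG sig"
      using left_ideal_socle_series[of k] by (simp add: left_ideal_def)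
    have "ret_rel sig k (g x) x" for x
    proof -
      obtain h where "h \<in> socle_series k" "g x = h x" using orb[of x] by (auto simp: perm.orb_def)
      moreover from this have "h \<in> permgrp sig" using N.mem_carrier by (simp add: brace_simps)
      ultimately show ?thesis using ret_rel_socle_series(3) by simp
    qed
    thus ?thesis using ret_rel_socle_series(3)[OF g] by blast
  qed
  obtain k where k: "\<And>x y. ret_rel sig k x y" using assms(2) by (auto simp: multipermutation_def)
  have "permgrp sig \<subseteq> socle_series k" using k ret_rel_socle_series(3)[of _ k] by blast
  moreover have "socle_series k \<subseteq> permgrp sig"
    using left_ideal_socle_series[of k] subgroup.subset by (fastforce simp: left_ideal_def brace_simps)
  ultimately show "\<exists>k. socle_series k = carrier (mulG sig)" by (auto simp: brace_simps)
qed (rule assms(3))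

end

section \<open>Assembly of the theorem\<close>

theorem theorem4p1:
  fixes sig gam :: "'a::finite \<Rightarrow> 'a \<Rightarrow> 'a"
    and n :: nat and p :: "nat \<Rightarrow> nat" and P :: "nat \<Rightarrow> ('a \<Rightarrow> 'a) set"
  assumes "n > 0"
    and "\<forall>i<n. Factorial_Ring.prime (p i)"
    and "inj_on p {..<n}"
    and "is_solution sig gam"
    and "indecomposable sig"
    and "multipermutation sig"
    and "card (UNIV :: 'a set) = (\<Prod>i<n. p i)"
    and "\<forall>i<n. sylow_subgroup (addG sig) (p i) (P i)"
  shows "(\<exists>\<pi>. \<pi> \<noteq> {} \<and> \<pi> \<subseteq> p ` {..<n} \<and> hall_subgroup (addG sig) \<pi> (soc sig))
    \<and> permgrp sig = mprod sig P n
    \<and> (\<forall>q. Factorial_Ring.prime q \<and> q dvd card (permgrp sig) \<longrightarrow> q \<in> p ` {..<n})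
    \<and> (\<forall>i<n. (\<forall>a\<in>P i. \<forall>b\<in>P i. a \<circ> b = gadd sig a b)
              \<and> (\<forall>a\<in>P i. a [^]\<^bsub>addG sig\<^esub> p i = id))
    \<and> (\<exists>\<tau>. \<tau> permutes {..<n}
         \<and> (\<forall>i\<in>{1..n}. brace_ideal sig (mprod sig (P \<circ> \<tau>) i))
         \<and> P (\<tau> 0) \<subseteq> soc sig
         \<and> (\<forall>i. 1 < i \<and> i \<le> n \<longrightarrow>
               quot_img sig (mprod sig (P \<circ> \<tau>) i) (mprod sig (P \<circ> \<tau>) (i - 1))
                 \<subseteq> quot_soc sig (mprod sig (P \<circ> \<tau>) (i - 1)))
         \<and> (\<forall>i\<in>{1..n}. stabset sig (mprod sig (P \<circ> \<tau>) i) = mprod sig (P \<circ> \<tau>) i))"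
proof -
  interpret solution sig gam by unfold_locales (rule assms(4))
  have prime: "\<And>i. i < n \<Longrightarrow> Factorial_Ring.prime (p i)"
    and sylow: "\<And>i. i < n \<Longrightarrow> sylow_subgroup (addG sig) (p i) (P i)"
    using assms(2,8) by blast+
  have "squarefree (\<Prod>i<n. p i)"
    using prime assms(3) by (intro squarefree_prod_coprime squarefree_prime)
      (auto simp: primes_coprime inj_on_eq_iff)
  then interpret T: transitive_brace "addG sig" "mulG sig"
    using transitive_brace assms(5-7) by simp
  note prems = prime assms(7) sylow
  have soc: "soc sig = socle_series 1"
    unfolding T.soc_eq by (simp add: soc_def brace_simps)
  have order: "order (addG sig) = card (permgrp sig)" by (simp add: order_def brace_simps)
  have degree: "q dvd card (UNIV :: 'a set) \<longleftrightarrow> q \<in> p ` {..<n}" if "Factorial_Ring.prime q" for q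
    using T.prime_dvd_degree_iff[OF prems that] by auto

  have hall: "\<exists>\<pi>. \<pi> \<noteq> {} \<and> \<pi> \<subseteq> p ` {..<n} \<and> hall_subgroup (addG sig) \<pi> (soc sig)"
  proof (intro exI conjI)
    \<comment> \<open>The primes of the socle are those dividing its orbit size D_1; there is one
      since X has more than one point.\<close>
    let ?\<pi> = "{q. Factorial_Ring.prime q \<and> q dvd T.D 1}"
    have "card (UNIV :: 'a set) \<noteq> 1"
      using T.p_dvd_degree[OF prems assms(1)] prime[OF assms(1)] not_prime_unit by auto
    moreover have "card (UNIV :: 'a set) \<noteq> 0" by simp
    ultimately have "card (UNIV :: 'a set) > 1" by linarith
    then obtain q where "Factorial_Ring.prime q" "q dvd T.D 1" by (rule T.ex_level_one)
    thus "?\<pi> \<noteq> {}" by blast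
    show "?\<pi> \<subseteq> p ` {..<n}" using degree T.D_dvd_degree dvd_trans by blast
    show "hall_subgroup (addG sig) ?\<pi> (soc sig)"
      unfolding hall_subgroup_def soc
      using T.N_subgroup(2)[of 1] T.prime_dvd_card_N[of _ 1] T.prime_not_dvd_index_N[of _ 1] by blast
  qed
  have prod: "permgrp sig = mprod sig P n"
    using T.iterated_prod_eq_B[OF prems permutes_id] unfolding mprod_eq by (simp add: brace_simps)
  have primes: "\<forall>q. Factorial_Ring.prime q \<and> q dvd card (permgrp sig) \<longrightarrow> q \<in> p ` {..<n}"
    using degree T.prime_dvd_order unfolding order by blast
  have trivial: "\<forall>i<n. (\<forall>a\<in>P i. \<forall>b\<in>P i. a \<circ> b = gadd sig a b) \<and> (\<forall>a\<in>P i. a [^]\<^bsub>addG sig\<^esub> p i = id)"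
    using T.P_trivial_brace[OF prems] T.P_elementary[OF prems] by (simp add: brace_simps)

  obtain \<tau> where \<tau>: "\<tau> permutes {..<n}" "P (\<tau> 0) \<subseteq> socle_series 1"
    and chain: "\<And>i. i < n \<Longrightarrow> \<exists>k. socle_series k \<subseteq> iterated_prod (P \<circ> \<tau>) i
      \<and> iterated_prod (P \<circ> \<tau>) (Suc i) \<subseteq> socle_series (Suc k)"
    using T.ex_chain[OF prems assms(1)] by blast
  let ?J = "iterated_prod (P \<circ> \<tau>)"
  have \<tau>_less: "\<tau> l < n" if "l < n" for l using permutes_in_image[OF \<tau>(1), of l] that by simp
  have left: "left_ideal ((P \<circ> \<tau>) l)" if "l < n" for l
    using T.P_left_ideal[OF prems \<tau>_less[OF that]] by simp
  have J_left: "left_ideal (?J i)" if "i \<le> n" for i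
    using left that by (intro left_ideal_iterated_prod) simp
  have J_mono: "?J i \<subseteq> ?J (Suc i)" if "i < n" for i
    using subset_set_mult(1)[OF J_left left] iterated_prod_Suc[of i "P \<circ> \<tau>"] left that by simp
  have J_ideal: "braceideal (?J (Suc i))" if i: "i < n" for i
  proof -
    obtain k where "socle_series k \<subseteq> ?J i" "?J (Suc i) \<subseteq> socle_series (Suc k)"
      using chain[OF i] by blast
    thus ?thesis
      using braceideal_between[OF braceideal_socle_series[of k] J_left[of "Suc i"]] J_mono[OF i] i
      by (simp del: iterated_prod.simps)
  qed
  \<comment> \<open>The congruence of product and sum modulo N_k passes to the larger left ideal
    \<open>?J i\<close>, where it becomes equality of left cosets.\<close>
  have quot: "quot_img sig (?J (Suc i)) (?J i) \<subseteq> quot_soc sig (?J i)" if i: "i < n" for i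
  proof -
    obtain k where k: "socle_series k \<subseteq> ?J i" "?J (Suc i) \<subseteq> socle_series (Suc k)"
      using chain[OF i] by blast
    have J: "subgroup (?J i) (mulG sig)" using J_left[of i] i left_ideal_subgroup_mul by simp
    have "a \<in> permgrp sig \<and> (\<forall>b\<in>permgrp sig. (a \<circ> b) <#\<^bsub>mulG sig\<^esub> ?J i = (gadd sig a b) <#\<^bsub>mulG sig\<^esub> ?J i)"
      if a: "a \<in> ?J (Suc i)" for a
    proof (intro conjI ballI)
      have aN: "a \<in> socle_over (socle_series k)" using a k by (auto simp del: iterated_prod.simps)
      thus aB: "a \<in> permgrp sig" by (simp add: socle_over_def brace_simps)
      fix b assume b: "b \<in> permgrp sig"
      have "a \<in> B" "b \<in> B" using aB b by (simp_all add: brace_simps)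
      hence B: "a \<boxplus> b \<in> B" "a \<star> b \<in> B" by simp_all
      have "neg (a \<boxplus> b) \<boxplus> a \<star> b \<in> socle_series k"
        using mul_congruent_add[OF braceideal_socle_series aN] b by (simp add: brace_simps(1))
      hence "rec (a \<boxplus> b) \<star> (a \<star> b) \<in> ?J i"
        using left_ideal_congruent[OF left_ideal_socle_series B] k by blast
      hence "a \<star> b \<in> (a \<boxplus> b) <#\<^bsub>mulG sig\<^esub> ?J i"
        unfolding l_coset_def using B mul_cancel(2)[of "a \<boxplus> b" "a \<star> b"] by force
      hence "(a \<boxplus> b) <#\<^bsub>mulG sig\<^esub> ?J i = (a \<star> b) <#\<^bsub>mulG sig\<^esub> ?J i"
        using mul.l_repr_independence[OF _ _ J] B carrier_eq by simp
      thus "(a \<circ> b) <#\<^bsub>mulG sig\<^esub> ?J i = (gadd sig a b) <#\<^bsub>mulG sig\<^esub> ?J i"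
        by (simp add: brace_simps)
    qed
    thus ?thesis unfolding quot_img_def quot_soc_def by blast
  qed
  have stab: "stabset sig (?J (Suc i)) = ?J (Suc i)" if i: "i < n" for i
  proof -
    obtain k where k: "socle_series k \<subseteq> ?J i" "?J (Suc i) \<subseteq> socle_series (Suc k)"
      using chain[OF i] by blast
    let ?L = "?J (Suc i)"
    have L: "subgroup ?L (mulG sig)" using J_left[of "Suc i"] i left_ideal_subgroup_mul by simp
    interpret L: subgroup ?L "mulG sig" by (rule L)
    have stab_eq: "stabset sig ?L = {g \<in> permgrp sig. \<forall>x. g ` perm.orb ?L x = perm.orb ?L x}"
      by (simp only: stabset_def perm.orb_def)
    have "g \<in> ?L" if g: "g \<in> permgrp sig" "\<And>x. g ` perm.orb ?L x = perm.orb ?L x" for g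
    proof (rule T.mem_of_preserves_orbits)
      show "?L \<lhd> mulG sig" using J_ideal[OF i] unfolding braceideal_def by blast
      show "socle_series k \<subseteq> ?L" using k(1) J_mono[OF i] by blast
      show "?L \<subseteq> socle_series (Suc k)" by (rule k(2))
      show "coprime (card ?L) (order (addG sig) div card ?L)"
        by (rule T.coprime_card_index_iterated_prod[OF prems]) (use \<tau>_less i in simp_all)
      show "g \<in> carrier (addG sig)" using g by (simp add: brace_simps)
      fix x
      have "x \<in> perm.orb ?L x" unfolding perm.orb_def using L.one_closed
        by (intro image_eqI[of _ _ id]) (simp_all add: brace_simps del: iterated_prod.simps)
      thus "g x \<in> perm.orb ?L x" using g(2)[of x] by blast
    qed
    moreover have "g ` perm.orb ?L x = perm.orb ?L x" if g: "g \<in> ?L" for g x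
    proof -
      have sub: "h ` perm.orb ?L x \<subseteq> perm.orb ?L x" if "h \<in> ?L" for h
      proof
        fix y assume "y \<in> h ` perm.orb ?L x"
        then obtain k where "k \<in> ?L" "y = (h \<star> k) x"
          unfolding perm.orb_def perm.mult_apply by blast
        thus "y \<in> perm.orb ?L x" unfolding perm.orb_def using L.m_closed[OF that] by blast
      qed
      have gG: "g \<in> carrier (mulG sig)" by (rule L.mem_carrier[OF g])
      \<comment> \<open>The reverse inclusion is the first one applied to the inverse of g.\<close>
      have "perm.orb ?L x = g ` rec g ` perm.orb ?L x"
        using gG by (simp add: image_image)
      also have "\<dots> \<subseteq> g ` perm.orb ?L x" by (intro image_mono sub L.m_inv_closed g)
      finally show ?thesis using sub[OF g] by blast
    qed
    moreover have "?L \<subseteq> permgrp sig" using L.subset by (simp add: brace_simps)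
    ultimately show ?thesis unfolding stab_eq by blast
  qed
  have pred: "\<exists>j<n. i = Suc j" if "i \<in> {1..n}" for i
    using that by (cases i) auto
  have "brace_ideal sig (mprod sig (P \<circ> \<tau>) i)" "stabset sig (mprod sig (P \<circ> \<tau>) i) = mprod sig (P \<circ> \<tau>) i"
    if "i \<in> {1..n}" for i
    using pred[OF that] J_ideal stab unfolding brace_ideal_eq mprod_eq by blast+
  moreover have "quot_img sig (mprod sig (P \<circ> \<tau>) i) (mprod sig (P \<circ> \<tau>) (i - 1))
      \<subseteq> quot_soc sig (mprod sig (P \<circ> \<tau>) (i - 1))" if i: "1 < i \<and> i \<le> n" for i
  proof -
    obtain j where "j < n" "i = Suc j" using pred[of i] i by auto
    thus ?thesis using quot unfolding mprod_eq by (simp del: iterated_prod.simps)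
  qed
  ultimately show ?thesis
    using hall prod primes trivial \<tau> unfolding soc by blast
qed

end
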